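(* Let $n\ge5$ and let $P^n_\omega$ be an edge-weighted path with vertices $x_1,\dots,x_n$, edges $e_i=\{x_i,x_{i+1}\}$ and weights $\omega_i=\omega(e_i)$, whose edge ideal $I=I(P^n_\omega)\subseteq S=\mathbb{K}[x_1,\dots,x_n]$ is integrally closed. Suppose $\omega_1>\omega_3$ and $\omega_i=1$ for all $i\ne1,3$. Then for every $t\ge1$: (1) if $\omega_3=1$, then $\operatorname{depth}(S/I^t)\ge\max\{\lceil\frac{n-t+1}{3}\rceil,1\}$; (2) if $\omega_3>1$, then $\operatorname{depth}(S/I^t)\ge\max\{\lceil\frac{n-t+1}{3}\rceil,2\}$.
   Context: $\mathbb{K}$ is a field. For a simple graph $G$ with weight function $\omega:E(G)\to\mathbb{Z}_{>0}$, $I(G_\omega)=(x_i^{\omega(e)}x_j^{\omega(e)}\mid e=\{x_i,x_j\}\in E(G))$. An ideal is integrally closed if it equals its integral closure. *)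

theory Defs
  imports Complex_Main "HOL-Library.Poly_Mapping" "HOL-Library.Extended_Nat"
begin

text \<open>Polynomials in variables indexed by nat, coefficients in a field 'k:
  a polynomial is a finitely supported map from monomials (exponent vectors
  in nat to nat with finite support) to coefficients.\<close>

type_synonym 'k mpoly = "(nat \<Rightarrow>\<^sub>0 nat) \<Rightarrow>\<^sub>0 'k"

definition Var :: "nat \<Rightarrow> 'k::comm_ring_1 mpoly" where
  "Var i = Poly_Mapping.single (Poly_Mapping.single i 1) 1"

definition polyring :: "nat \<Rightarrow> 'k::comm_ring_1 mpoly set" where
  "polyring n = {p :: 'k mpoly. \<forall>m \<in> Poly_Mapping.keys p. \<forall>i \<in> Poly_Mapping.keys m. 1 \<le> i \<and> i \<le> n}"

definition ideal_gen :: "'a::comm_ring_1 set \<Rightarrow> 'a set \<Rightarrow> 'a set" where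
  "ideal_gen R G = {\<Sum>g\<in>F. c g * g | F c. finite F \<and> F \<subseteq> G \<and> (\<forall>g\<in>F. c g \<in> R)}"

definition ideal_mult :: "'a::comm_ring_1 set \<Rightarrow> 'a set \<Rightarrow> 'a set \<Rightarrow> 'a set" where
  "ideal_mult R I J = ideal_gen R {a * b | a b. a \<in> I \<and> b \<in> J}"

fun ideal_pow :: "'a::comm_ring_1 set \<Rightarrow> 'a set \<Rightarrow> nat \<Rightarrow> 'a set" where
  "ideal_pow R I 0 = R"
| "ideal_pow R I (Suc k) = ideal_mult R I (ideal_pow R I k)"

definition integral_over_ideal :: "'a::comm_ring_1 set \<Rightarrow> 'a set \<Rightarrow> 'a \<Rightarrow> bool" where
  "integral_over_ideal R I f \<longleftrightarrow> f \<in> R \<and>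
     (\<exists>k\<ge>1. \<exists>a :: nat \<Rightarrow> 'a. (\<forall>i\<in>{1..k}. a i \<in> ideal_pow R I i) \<and>
        f ^ k + (\<Sum>i=1..k. a i * f ^ (k - i)) = 0)"

definition integral_closure :: "'a::comm_ring_1 set \<Rightarrow> 'a set \<Rightarrow> 'a set" where
  "integral_closure R I = {f. integral_over_ideal R I f}"

definition integrally_closed :: "'a::comm_ring_1 set \<Rightarrow> 'a set \<Rightarrow> bool" where
  "integrally_closed R I \<longleftrightarrow> integral_closure R I = I"

definition regular_seq :: "'a::comm_ring_1 set \<Rightarrow> 'a set \<Rightarrow> 'a set \<Rightarrow> 'a list \<Rightarrow> bool" where
  "regular_seq R m J fs \<longleftrightarrow> set fs \<subseteq> m \<and>
     (\<forall>i < length fs. \<forall>g \<in> R.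
        fs ! i * g \<in> ideal_gen R (J \<union> set (take i fs)) \<longrightarrow> g \<in> ideal_gen R (J \<union> set (take i fs))) \<and>
     1 \<notin> ideal_gen R (J \<union> set fs)"

definition depth :: "'a::comm_ring_1 set \<Rightarrow> 'a set \<Rightarrow> 'a set \<Rightarrow> enat" where
  "depth R m J = (SUP fs \<in> {fs. regular_seq R m J fs}. enat (length fs))"

definition max_ideal :: "nat \<Rightarrow> 'k::comm_ring_1 mpoly set" where
  "max_ideal n = ideal_gen (polyring n) {Var i | i. 1 \<le> i \<and> i \<le> n}"

definition weighted_path_ideal :: "nat \<Rightarrow> (nat \<Rightarrow> nat) \<Rightarrow> 'k::comm_ring_1 mpoly set" where
  "weighted_path_ideal n w = ideal_gen (polyring n)
     {Var i ^ w i * Var (Suc i) ^ w i | i. 1 \<le> i \<and> i < n}"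

end

theory Submission
  imports Defs
begin

text \<open>
  Depth is bounded below by exhibiting a regular sequence: the elementary symmetric polynomials
  \<open>e\<^sub>1, \<dots>, e\<^sub>d\<close> in all \<open>N\<close> variables. They are regular modulo every monomial prime with at least \<open>d\<close>
  free variables. Being independent of the ideal, they pass from \<open>S/(J:x\<^sub>i)\<close> and
  \<open>S/(J,x\<^sub>i)\<close> to \<open>S/J\<close> without any homological algebra. It therefore suffices to split \<open>I\<^sup>t\<close> repeatedly by
  variables until only primes of dimension at least \<open>d\<close> remain.

  At the far end of the path, an edge of weight one can be cancelled: \<open>I\<^sup>t : x\<^sub>n\<^sub>-\<^sub>1x\<^sub>n = I\<^sup>t\<^sup>-\<^sup>1\<close>. Splitting by
  \<open>x\<^sub>n\<^sub>-\<^sub>1\<close>, \<open>x\<^sub>n\<close> and \<open>x\<^sub>n\<^sub>-\<^sub>2\<close> reduces \<open>(n, t)\<close> to \<open>(n, t-1)\<close>, \<open>(n-1, t-1)\<close>, and, with one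
  free variable gained, \<open>(n-2, t)\<close> and \<open>(n-3, t)\<close>. If \<open>\<omega>\<^sub>3 > 1\<close>, the cases \<open>n = 4, 5\<close> are split by
  \<open>x\<^sub>2\<close> and \<open>x\<^sub>3\<close> instead: the product of the two heavy generators lies in \<open>(x\<^sub>2\<^sup>2x\<^sub>3\<^sup>2)\<close>, so
  \<open>I\<^sup>t : x\<^sub>2x\<^sub>3 = I\<^sup>t\<^sup>-\<^sup>1\<close> there too.
\<close>

section \<open>Weakly regular sequences\<close>

text \<open>Rings are carrier sets inside a type because \<open>polyring N\<close> is only a subset
  of the type of all polynomials. Closure under subtraction already yields zero, negatives and
  sums.\<close>

locale subring_carrier =
  fixes R :: "'a::comm_ring_1 set"
  assumes one_closed: "1 \<in> R"
    and diff_closed: "a \<in> R \<Longrightarrow> b \<in> R \<Longrightarrow> a - b \<in> R"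
    and mult_closed: "a \<in> R \<Longrightarrow> b \<in> R \<Longrightarrow> a * b \<in> R"
begin

lemma zero_closed: "0 \<in> R"
  using diff_closed[OF one_closed one_closed] by simp

lemma uminus_closed: "a \<in> R \<Longrightarrow> - a \<in> R"
  using diff_closed[OF zero_closed] by simp

lemma add_closed: "a \<in> R \<Longrightarrow> b \<in> R \<Longrightarrow> a + b \<in> R"
  using diff_closed[of a "- b"] uminus_closed by simp

definition is_ideal :: "'a set \<Rightarrow> bool" where
  "is_ideal J \<longleftrightarrow> J \<subseteq> R \<and> 0 \<in> J \<and> (\<forall>a\<in>J. \<forall>b\<in>J. a + b \<in> J) \<and> (\<forall>r\<in>R. \<forall>a\<in>J. r * a \<in> J)"

lemma is_idealI:
  assumes "J \<subseteq> R" "0 \<in> J" "\<And>a b. a \<in> J \<Longrightarrow> b \<in> J \<Longrightarrow> a + b \<in> J"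
    "\<And>r a. r \<in> R \<Longrightarrow> a \<in> J \<Longrightarrow> r * a \<in> J"
  shows "is_ideal J"
  using assms by (auto simp: is_ideal_def)

context
  fixes J assumes J: "is_ideal J"
begin

lemma ideal_subset: "a \<in> J \<Longrightarrow> a \<in> R"
  and ideal_zero: "0 \<in> J"
  and ideal_add: "a \<in> J \<Longrightarrow> b \<in> J \<Longrightarrow> a + b \<in> J"
  and ideal_mult_left: "r \<in> R \<Longrightarrow> a \<in> J \<Longrightarrow> r * a \<in> J"
  using J by (auto simp: is_ideal_def)

lemma ideal_mult_right: "a \<in> J \<Longrightarrow> r \<in> R \<Longrightarrow> a * r \<in> J"
  using ideal_mult_left[of r a] by (simp add: mult.commute)

lemma ideal_uminus: "a \<in> J \<Longrightarrow> - a \<in> J"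
  using ideal_mult_left[of "-1" a] uminus_closed[OF one_closed] by simp

lemma ideal_diff: "a \<in> J \<Longrightarrow> b \<in> J \<Longrightarrow> a - b \<in> J"
  using ideal_add[of a "- b"] ideal_uminus by simp

lemma ideal_sum: "(\<And>i. i \<in> A \<Longrightarrow> f i \<in> J) \<Longrightarrow> sum f A \<in> J"
  by (induction A rule: infinite_finite_induct) (auto intro: ideal_zero ideal_add)

end

definition adjoin :: "'a set \<Rightarrow> 'a \<Rightarrow> 'a set" where
  "adjoin J f = {a + f * b | a b. a \<in> J \<and> b \<in> R}"

lemma adjoinI: "a \<in> J \<Longrightarrow> b \<in> R \<Longrightarrow> x = a + f * b \<Longrightarrow> x \<in> adjoin J f"
  by (auto simp: adjoin_def)

lemma adjoinE:
  assumes "x \<in> adjoin J f" obtains a b where "a \<in> J" "b \<in> R" "x = a + f * b"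
  using assms by (auto simp: adjoin_def)

lemma adjoin_superset: "a \<in> J \<Longrightarrow> a \<in> adjoin J f"
  by (rule adjoinI[of a J 0]) (auto simp: zero_closed)

lemma adjoin_generator: "is_ideal J \<Longrightarrow> r \<in> R \<Longrightarrow> f * r \<in> adjoin J f"
  by (rule adjoinI[of 0 J r]) (auto simp: ideal_zero)

lemma is_ideal_adjoin:
  assumes "is_ideal J" "f \<in> R" shows "is_ideal (adjoin J f)"
proof (rule is_idealI)
  show "adjoin J f \<subseteq> R"
    using assms by (auto simp: adjoin_def intro!: add_closed mult_closed dest: ideal_subset)
  show "0 \<in> adjoin J f" using assms by (intro adjoin_superset ideal_zero)
next
  fix a b assume "a \<in> adjoin J f" "b \<in> adjoin J f"
  then obtain a1 a2 b1 b2 where "a1 \<in> J" "a2 \<in> R" "a = a1 + f * a2" "b1 \<in> J" "b2 \<in> R" "b = b1 + f * b2"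
    by (auto elim!: adjoinE)
  then show "a + b \<in> adjoin J f"
    using assms by (intro adjoinI[of "a1 + b1" J "a2 + b2"]) (auto intro: ideal_add add_closed simp: algebra_simps)
next
  fix r a assume "r \<in> R" "a \<in> adjoin J f"
  then obtain a1 a2 where "a1 \<in> J" "a2 \<in> R" "a = a1 + f * a2" by (auto elim!: adjoinE)
  with \<open>r \<in> R\<close> show "r * a \<in> adjoin J f"
    using assms by (intro adjoinI[of "r * a1" J "r * a2"]) (auto intro: ideal_mult_left mult_closed simp: distrib_left mult.left_commute)
qed

lemma adjoin_least:
  assumes "is_ideal K" "J \<subseteq> K" "f \<in> K" shows "adjoin J f \<subseteq> K"
  using assms by (auto elim!: adjoinE intro!: ideal_add ideal_mult_right)

lemma adjoin_commute:
  assumes "is_ideal J" shows "adjoin (adjoin J f) g = adjoin (adjoin J g) f"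
proof -
  have "adjoin (adjoin J f) g \<subseteq> adjoin (adjoin J g) f" for f g
  proof
    fix x assume "x \<in> adjoin (adjoin J f) g"
    then obtain a b c where "a \<in> J" "b \<in> R" "c \<in> R" "x = (a + f * b) + g * c" by (auto elim!: adjoinE)
    then show "x \<in> adjoin (adjoin J g) f"
      by (intro adjoinI[of "a + g * c" _ b] adjoinI[of a J c]) (auto simp: algebra_simps)
  qed
  then show ?thesis by blast
qed

primrec adjoin_list :: "'a set \<Rightarrow> 'a list \<Rightarrow> 'a set" where
  "adjoin_list J [] = J"
| "adjoin_list J (f # fs) = adjoin_list (adjoin J f) fs"

lemma is_ideal_adjoin_list: "is_ideal J \<Longrightarrow> set fs \<subseteq> R \<Longrightarrow> is_ideal (adjoin_list J fs)"
  by (induction fs arbitrary: J) (auto intro: is_ideal_adjoin)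

lemma adjoin_list_superset: "J \<subseteq> adjoin_list J fs"
proof (induction fs arbitrary: J)
  case (Cons f fs)
  have "J \<subseteq> adjoin J f" using adjoin_superset by blast
  also have "\<dots> \<subseteq> adjoin_list J (f # fs)" using Cons[of "adjoin J f"] by simp
  finally show ?case .
qed simp

lemma adjoin_list_contains:
  assumes "is_ideal J" shows "set fs \<subseteq> R \<Longrightarrow> set fs \<subseteq> adjoin_list J fs"
  using assms
proof (induction fs arbitrary: J)
  case (Cons f fs)
  have "f \<in> adjoin J f" using adjoin_generator[OF Cons.prems(2) one_closed, of f] by simp
  then show ?case
    using Cons adjoin_list_superset[of "adjoin J f" fs] is_ideal_adjoin by auto
qed simp

lemma adjoin_list_least: "is_ideal K \<Longrightarrow> J \<subseteq> K \<Longrightarrow> set fs \<subseteq> K \<Longrightarrow> adjoin_list J fs \<subseteq> K"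
  by (induction fs arbitrary: J) (auto dest: adjoin_least)

definition nonzerodivisor_mod :: "'a set \<Rightarrow> 'a \<Rightarrow> bool" where
  "nonzerodivisor_mod J f \<longleftrightarrow> (\<forall>g\<in>R. f * g \<in> J \<longrightarrow> g \<in> J)"

lemma nonzerodivisor_modD: "nonzerodivisor_mod J f \<Longrightarrow> f * g \<in> J \<Longrightarrow> g \<in> R \<Longrightarrow> g \<in> J"
  by (auto simp: nonzerodivisor_mod_def)

text \<open>The sequence may generate the unit ideal together with \<open>J\<close>. This allows the
  whole ring as a piece of a splitting; properness is restored in
  \<open>regular_seqI\<close>.\<close>

primrec weakly_regular :: "'a set \<Rightarrow> 'a list \<Rightarrow> bool" where
  "weakly_regular J [] \<longleftrightarrow> True"
| "weakly_regular J (f # fs) \<longleftrightarrow> nonzerodivisor_mod J f \<and> weakly_regular (adjoin J f) fs"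

lemma weakly_regular_append:
  "weakly_regular J (fs @ gs) \<longleftrightarrow> weakly_regular J fs \<and> weakly_regular (adjoin_list J fs) gs"
  by (induction fs arbitrary: J) auto

lemma weakly_regular_unit: "R \<subseteq> J \<Longrightarrow> weakly_regular J fs"
proof (induction fs arbitrary: J)
  case (Cons f fs)
  then have "R \<subseteq> adjoin J f" using adjoin_superset by blast
  then show ?case using Cons by (auto simp: nonzerodivisor_mod_def)
qed simp

definition colon :: "'a set \<Rightarrow> 'a \<Rightarrow> 'a set" where
  "colon J g = {p \<in> R. g * p \<in> J}"

text \<open>As \<open>f\<close> is regular on R/(J,g), the snake lemma keeps 0 -> R/(J:g) -> R/J ->
  R/(J,g) -> 0 exact after reduction modulo \<open>f\<close>. Concretely, g p = a + f u puts u in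
  (J,g), say u = b + g v, and then p - f v lies in J:g.\<close>

lemma colon_adjoin:
  assumes J: "is_ideal J" and fg: "f \<in> R" "g \<in> R" and f: "nonzerodivisor_mod (adjoin J g) f"
  shows "colon (adjoin J f) g = adjoin (colon J g) f"
proof (intro equalityI subsetI)
  fix p assume "p \<in> colon (adjoin J f) g"
  then have p: "p \<in> R" "g * p \<in> adjoin J f" by (auto simp: colon_def)
  then obtain a u where a: "a \<in> J" "u \<in> R" "g * p = a + f * u" by (auto elim: adjoinE)
  then have "f * u = - a + g * p" by simp
  then have "f * u \<in> adjoin J g" using a p J by (intro adjoinI[of "-a" J p]) (auto intro: ideal_uminus)
  then have "u \<in> adjoin J g" using f a by (auto dest: nonzerodivisor_modD)
  then obtain b v where b: "b \<in> J" "v \<in> R" "u = b + g * v" by (auto elim: adjoinE)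
  have "g * (p - f * v) = a + f * b" using a b by (simp add: algebra_simps)
  moreover have "a + f * b \<in> J" using a b J fg by (auto intro: ideal_add ideal_mult_left)
  ultimately have "p - f * v \<in> colon J g"
    using p b fg by (simp add: colon_def diff_closed mult_closed)
  then show "p \<in> adjoin (colon J g) f" using b by (intro adjoinI[of "p - f * v" _ v]) auto
next
  fix p assume "p \<in> adjoin (colon J g) f"
  then obtain a b where a: "a \<in> R" "g * a \<in> J" "b \<in> R" "p = a + f * b" by (auto elim!: adjoinE simp: colon_def)
  then have "g * p \<in> adjoin J f"
    using fg by (intro adjoinI[of "g * a" _ "g * b"]) (auto simp: algebra_simps mult_closed)
  then show "p \<in> colon (adjoin J f) g" using a fg by (auto simp: colon_def add_closed mult_closed)
qed

text \<open>This is the depth lemma for \<open>0 \<rightarrow> R/(J:g) \<rightarrow> R/J \<rightarrow> R/(J,g) \<rightarrow> 0\<close>: it is elementary because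
  the same sequence serves both ends.\<close>

lemma weakly_regular_split:
  assumes "is_ideal J" "g \<in> R" "set fs \<subseteq> R"
    and "weakly_regular (colon J g) fs" "weakly_regular (adjoin J g) fs"
  shows "weakly_regular J fs"
  using assms
proof (induction fs arbitrary: J)
  case (Cons f fs)
  note J = \<open>is_ideal J\<close> and g = \<open>g \<in> R\<close>
  have f: "f \<in> R" and fs: "set fs \<subseteq> R" using Cons.prems by auto
  have f1: "nonzerodivisor_mod (colon J g) f" and f2: "nonzerodivisor_mod (adjoin J g) f"
    and r1: "weakly_regular (adjoin (colon J g) f) fs" and r2: "weakly_regular (adjoin (adjoin J g) f) fs"
    using Cons.prems by auto
  \<comment> \<open>Regularity modulo (J,g) writes p = a + g v. Then f v lies in J:g, and regularity
    there puts g v into \<open>J\<close>.\<close>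
  have "nonzerodivisor_mod J f"
    unfolding nonzerodivisor_mod_def
  proof (intro ballI impI)
    fix p assume p: "p \<in> R" "f * p \<in> J"
    then have "p \<in> adjoin J g" using f2 adjoin_superset by (auto dest: nonzerodivisor_modD)
    then obtain a v where a: "a \<in> J" "v \<in> R" "p = a + g * v" by (auto elim: adjoinE)
    have "g * (f * v) = f * p - f * a" using a by (simp add: algebra_simps)
    then have "g * (f * v) \<in> J" using p a f J by (auto intro: ideal_diff ideal_mult_left)
    then have "f * v \<in> colon J g" using f a by (simp add: colon_def mult_closed)
    then have "v \<in> colon J g" using f1 a by (auto dest: nonzerodivisor_modD)
    then show "p \<in> J" using a J by (auto simp: colon_def intro: ideal_add)
  qed
  \<comment> \<open>The two pieces of (J,f) are (J:g,f) and (J,g,f), exactly the ideals left by the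
    first step of the two given sequences.\<close>
  moreover have "weakly_regular (adjoin J f) fs"
    using Cons.IH[OF is_ideal_adjoin[OF J f] g fs] r1 r2
      colon_adjoin[OF J f g f2] adjoin_commute[OF J, of f g] by simp
  ultimately show ?case by simp
qed simp

end

text \<open>\<open>T k a\<close> stands for the part of \<open>a\<close> in degrees below \<open>k\<close>; all that is needed of the grading
  can be said with these truncations.\<close>

locale truncated_ring = subring_carrier R for R :: "'a::comm_ring_1 set" +
  fixes T :: "nat \<Rightarrow> 'a \<Rightarrow> 'a"
  assumes T_closed: "a \<in> R \<Longrightarrow> T k a \<in> R"
    and T_add: "T k (a + b) = T k a + T k b"
    and T_0: "T 0 a = 0"
    and T_exhaustive: "\<exists>k. T k a = a"
begin

lemma T_diff: "T k (a - b) = T k a - T k b"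
  using T_add[of k "a - b" b] by simp

text \<open>Multiplication by \<open>f\<close> raises degrees by \<open>d\<close>. For k \<le> d the
  natural subtraction gives \<open>T 0 h\<close>, which is 0: nothing of f h lies below degree
  d.\<close>

definition homogeneous :: "nat \<Rightarrow> 'a \<Rightarrow> bool" where
  "homogeneous d f \<longleftrightarrow> (\<forall>k h. T k (f * h) = f * T (k - d) h)"

text \<open>For ideals this plays the part of being graded.\<close>

definition T_stable :: "'a set \<Rightarrow> bool" where
  "T_stable J \<longleftrightarrow> (\<forall>k. \<forall>a\<in>J. T k a \<in> J)"

lemma T_stable_adjoin:
  assumes "T_stable J" "homogeneous d f" shows "T_stable (adjoin J f)"
  unfolding T_stable_def
proof (intro allI ballI)
  fix k x assume "x \<in> adjoin J f"
  then obtain a b where "a \<in> J" "b \<in> R" "x = a + f * b" by (auto elim: adjoinE)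
  then show "T k x \<in> adjoin J f"
    using assms by (intro adjoinI[of "T k a" _ "T (k - d) b"])
      (auto simp: T_stable_def homogeneous_def T_add T_closed)
qed

lemma homogeneous_power: "homogeneous d f \<Longrightarrow> homogeneous (j * d) (f ^ j)"
proof (induction j)
  case (Suc j)
  then show ?case by (simp add: homogeneous_def mult.assoc diff_diff_left)
qed (simp add: homogeneous_def)

text \<open>If \<open>f g \<in> J\<close>, then \<open>g\<close> is divisible by every power of \<open>x\<close> modulo \<open>J\<close>; the grading replaces
  Nakayama's lemma in concluding \<open>g \<in> J\<close>.\<close>

lemma nonzerodivisor_mod_lift:
  assumes J: "is_ideal J" "T_stable J" and x: "x \<in> R" "homogeneous d x" "d > 0"
    and nzx: "nonzerodivisor_mod J x"
    and f: "f \<in> R" "nonzerodivisor_mod (adjoin J x) f"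
  shows "nonzerodivisor_mod J f"
  unfolding nonzerodivisor_mod_def
proof (intro ballI impI)
  fix g assume g: "g \<in> R" "f * g \<in> J"
  have pow: "x ^ k \<in> R" for k using x by (induction k) (auto simp: one_closed mult_closed)
  \<comment> \<open>The invariant keeps f h in \<open>J\<close>, so that the cofactor h can be
    divided by x once more.\<close>
  have "\<exists>h\<in>R. g - x ^ k * h \<in> J \<and> f * h \<in> J" for k
  proof (induction k)
    case 0
    then show ?case using g J by (intro bexI[of _ g]) (auto simp: ideal_zero)
  next
    case (Suc k)
    then obtain h where h: "h \<in> R" "g - x ^ k * h \<in> J" "f * h \<in> J" by blast
    then have "h \<in> adjoin J x" using f adjoin_superset by (auto dest: nonzerodivisor_modD)
    then obtain j h' where j: "j \<in> J" "h' \<in> R" "h = j + x * h'" by (auto elim: adjoinE)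
    have eq: "g - x ^ Suc k * h' = (g - x ^ k * h) + x ^ k * j" using j by (simp add: algebra_simps)
    have 1: "g - x ^ Suc k * h' \<in> J"
      using ideal_add[OF J(1) h(2) ideal_mult_left[OF J(1) pow j(1)]] by (simp only: eq)
    have "x * (f * h') = f * h - f * j" using j by (simp add: algebra_simps)
    then have "x * (f * h') \<in> J" using h j J f by (auto intro: ideal_diff ideal_mult_left)
    then have "f * h' \<in> J" using nzx f j by (auto dest: nonzerodivisor_modD simp: mult_closed)
    then show ?case using 1 j by blast
  qed
  moreover obtain k where k: "T k g = g" using T_exhaustive by blast
  ultimately obtain h where h: "g - x ^ k * h \<in> J" by blast
  \<comment> \<open>As d > 0, the power x^k has degree at least k, so truncation below k leaves only
    g.\<close>
  have "T k (x ^ k * h) = 0"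
    using homogeneous_power[OF x(2), of k] x(3) by (simp add: homogeneous_def T_0)
  then have "T k (g - x ^ k * h) = g" by (simp add: T_diff k)
  then show "g \<in> J" using h J(2) unfolding T_stable_def by metis
qed

text \<open>Homogeneous regular sequences may be reordered: x travels from the front to the end,
  past one f at a time. That f is regular before x needs the grading; that x stays regular after f
  is elementary.\<close>

lemma weakly_regular_permute:
  assumes "is_ideal J" "T_stable J" and x: "x \<in> R" "homogeneous d x" "d > 0"
    and "nonzerodivisor_mod J x" "weakly_regular (adjoin J x) fs"
    and "\<And>f. f \<in> set fs \<Longrightarrow> f \<in> R \<and> (\<exists>d. homogeneous d f)"
  shows "weakly_regular J fs \<and> nonzerodivisor_mod (adjoin_list J fs) x"
  using assms(1,2,6,7,8)
proof (induction fs arbitrary: J)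
  case (Cons f fs)
  note J = \<open>is_ideal J\<close> \<open>T_stable J\<close> and nzx = \<open>nonzerodivisor_mod J x\<close>
  obtain e where f: "f \<in> R" "homogeneous e f" using Cons.prems by auto
  have f2: "nonzerodivisor_mod (adjoin J x) f" using Cons.prems by simp
  have nzf: "nonzerodivisor_mod J f"
    using nonzerodivisor_mod_lift[OF J x nzx f(1) f2] .
  \<comment> \<open>From x h = a + f u, regularity of f modulo (J,x) gives u = b + x v; then x (h -
    f v) lies in \<open>J\<close> and x can be cancelled.\<close>
  have "nonzerodivisor_mod (adjoin J f) x"
    unfolding nonzerodivisor_mod_def
  proof (intro ballI impI)
    fix h assume h: "h \<in> R" "x * h \<in> adjoin J f"
    then obtain a u where a: "a \<in> J" "u \<in> R" "x * h = a + f * u" by (auto elim: adjoinE)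
    then have "f * u = - a + x * h" by simp
    then have "f * u \<in> adjoin J x" using a h J by (intro adjoinI[of "-a" J h]) (auto intro: ideal_uminus)
    then have "u \<in> adjoin J x" using f2 a by (auto dest: nonzerodivisor_modD)
    then obtain b v where b: "b \<in> J" "v \<in> R" "u = b + x * v" by (auto elim: adjoinE)
    have "x * (h - f * v) = a + f * b" using a b by (simp add: algebra_simps)
    also have "\<dots> \<in> J" using a b J f by (auto intro: ideal_add ideal_mult_left)
    finally have "h - f * v \<in> J" using nzx h f b by (auto dest: nonzerodivisor_modD simp: diff_closed mult_closed)
    then show "h \<in> adjoin J f" using b by (intro adjoinI[of "h - f * v" _ v]) auto
  qed
  then have "weakly_regular (adjoin J f) fs \<and> nonzerodivisor_mod (adjoin_list (adjoin J f) fs) x"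
    using Cons.prems adjoin_commute[OF J(1), of x f]
    by (intro Cons.IH) (auto intro: is_ideal_adjoin[OF J(1) f(1)] T_stable_adjoin[OF J(2) f(2)])
  then show ?case using nzf by simp
qed simp

end

section \<open>Generated ideals and regular sequences in the sense of
  \<open>regular_seq\<close>\<close>

context subring_carrier
begin

lemma ideal_gen_least: "is_ideal J \<Longrightarrow> G \<subseteq> J \<Longrightarrow> ideal_gen R G \<subseteq> J"
  by (auto simp: ideal_gen_def intro!: ideal_sum ideal_mult_left)

lemma ideal_gen_superset: "G \<subseteq> ideal_gen R G"
proof
  fix g assume "g \<in> G"
  then show "g \<in> ideal_gen R G"
    unfolding ideal_gen_def using one_closed by (intro CollectI exI[of _ "{g}"] exI[of _ "\<lambda>_. 1"]) auto
qed

lemma is_ideal_ideal_gen: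
  assumes "G \<subseteq> R" shows "is_ideal (ideal_gen R G)"
proof (rule is_idealI)
  have "is_ideal R" by (rule is_idealI) (auto intro: zero_closed add_closed mult_closed)
  then show "ideal_gen R G \<subseteq> R" using assms by (rule ideal_gen_least)
  show "0 \<in> ideal_gen R G"
    unfolding ideal_gen_def by (intro CollectI exI[of _ "{}"] exI[of _ "\<lambda>_. 1"]) auto
next
  fix a b assume "a \<in> ideal_gen R G" "b \<in> ideal_gen R G"
  then obtain F c E e where F: "finite F" "F \<subseteq> G" "\<forall>g\<in>F. c g \<in> R" "a = (\<Sum>g\<in>F. c g * g)"
    and E: "finite E" "E \<subseteq> G" "\<forall>g\<in>E. e g \<in> R" "b = (\<Sum>g\<in>E. e g * g)"
    unfolding ideal_gen_def by blast
  \<comment> \<open>The two combinations may use different finite sets of generators; both are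
    extended by zero to the union.\<close>
  define h where "h g = (if g \<in> F then c g else 0) + (if g \<in> E then e g else 0)" for g
  have "(\<Sum>g\<in>F \<union> E. h g * g)
      = (\<Sum>g\<in>F \<union> E. if g \<in> F then c g * g else 0) + (\<Sum>g\<in>F \<union> E. if g \<in> E then e g * g else 0)"
    unfolding sum.distrib[symmetric] by (rule sum.cong) (auto simp: h_def algebra_simps)
  also have "\<dots> = a + b"
    using F E by (simp add: sum.If_cases Int_absorb1 Int_absorb2 flip: sum.inter_restrict)
  finally show "a + b \<in> ideal_gen R G"
    using F E unfolding ideal_gen_def
    by (intro CollectI exI[of _ "F \<union> E"] exI[of _ h]) (auto simp: h_def intro: add_closed)
next
  fix r a assume "r \<in> R" "a \<in> ideal_gen R G"
  then obtain F c where "finite F" "F \<subseteq> G" "\<forall>g\<in>F. c g \<in> R" "a = (\<Sum>g\<in>F. c g * g)"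
    unfolding ideal_gen_def by blast
  then show "r * a \<in> ideal_gen R G"
    using \<open>r \<in> R\<close> unfolding ideal_gen_def
    by (intro CollectI exI[of _ F] exI[of _ "\<lambda>g. r * c g"]) (auto simp: sum_distrib_left mult.assoc mult_closed)
qed

lemma adjoin_list_eq_ideal_gen:
  assumes "is_ideal J" "set fs \<subseteq> R"
  shows "ideal_gen R (J \<union> set fs) = adjoin_list J fs"
proof
  show "ideal_gen R (J \<union> set fs) \<subseteq> adjoin_list J fs"
    using assms adjoin_list_superset adjoin_list_contains by (intro ideal_gen_least is_ideal_adjoin_list) auto
  have "J \<union> set fs \<subseteq> R" using assms ideal_subset by auto
  then show "adjoin_list J fs \<subseteq> ideal_gen R (J \<union> set fs)"
    using ideal_gen_superset[of "J \<union> set fs"] by (intro adjoin_list_least is_ideal_ideal_gen) auto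
qed

text \<open>Properness is witnessed by any ideal \<open>M\<close> that contains everything and
  misses 1. It is kept apart from \<open>m\<close>, so a description of \<open>M\<close> can be
  chosen in which this is evident.\<close>

lemma regular_seqI:
  assumes "is_ideal J" "set fs \<subseteq> R" "weakly_regular J fs" "set fs \<subseteq> m"
    and M: "is_ideal M" "J \<subseteq> M" "set fs \<subseteq> M" "1 \<notin> M"
  shows "regular_seq R m J fs"
  unfolding regular_seq_def
proof (intro conjI allI impI ballI)
  show "1 \<notin> ideal_gen R (J \<union> set fs)" using ideal_gen_least[of M "J \<union> set fs"] M by auto
  fix i g assume i: "i < length fs" and g: "g \<in> R" "fs ! i * g \<in> ideal_gen R (J \<union> set (take i fs))"
  have "set (take i fs) \<subseteq> R" using assms(2) set_take_subset[of i fs] by blast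
  then have eq: "ideal_gen R (J \<union> set (take i fs)) = adjoin_list J (take i fs)"
    by (rule adjoin_list_eq_ideal_gen[OF assms(1)])
  have "weakly_regular J (take i fs @ fs ! i # drop (Suc i) fs)"
    using assms(3) i by (simp add: id_take_nth_drop[symmetric])
  then have "nonzerodivisor_mod (adjoin_list J (take i fs)) (fs ! i)"
    by (simp add: weakly_regular_append)
  then show "g \<in> ideal_gen R (J \<union> set (take i fs))" using g eq by (auto dest: nonzerodivisor_modD)
qed (rule assms(4))

end

section \<open>Monomial ideals and elementary symmetric polynomials\<close>

text \<open>On \<open>polyring N\<close> this is the total degree.\<close>

definition weight :: "nat \<Rightarrow> (nat \<Rightarrow>\<^sub>0 nat) \<Rightarrow> nat" where
  "weight N m = (\<Sum>i\<in>{1..N}. Poly_Mapping.lookup m i)"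

lemma weight_add: "weight N (a + b) = weight N a + weight N b"
  by (simp add: weight_def lookup_add sum.distrib)

definition trunc :: "nat \<Rightarrow> nat \<Rightarrow> 'k::comm_ring_1 mpoly \<Rightarrow> 'k mpoly" where
  "trunc N k p = Poly_Mapping.mapp (\<lambda>m c. c when weight N m < k) p"

lemma lookup_trunc: "Poly_Mapping.lookup (trunc N k p) m = (Poly_Mapping.lookup p m when weight N m < k)"
  by (auto simp: trunc_def lookup_mapp when_def in_keys_iff)

lemma keys_trunc: "Poly_Mapping.keys (trunc N k p) = {m \<in> Poly_Mapping.keys p. weight N m < k}"
  by (auto simp: in_keys_iff lookup_trunc)

lemma trunc_id: "(\<And>m. m \<in> Poly_Mapping.keys p \<Longrightarrow> weight N m < k) \<Longrightarrow> trunc N k p = p"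
  by (rule poly_mapping_eqI) (auto simp: lookup_trunc when_def in_keys_iff)

lemma trunc_eq_0: "(\<And>m. m \<in> Poly_Mapping.keys p \<Longrightarrow> k \<le> weight N m) \<Longrightarrow> trunc N k p = 0"
  by (rule poly_mapping_eqI) (fastforce simp: lookup_trunc when_def in_keys_iff)

lemma trunc_add: "trunc N k (p + q) = trunc N k p + trunc N k q"
  by (rule poly_mapping_eqI) (simp add: lookup_trunc lookup_add when_add_distrib)

lemma keys_multE:
  assumes "m \<in> Poly_Mapping.keys (p * q)"
  obtains a b where "a \<in> Poly_Mapping.keys p" "b \<in> Poly_Mapping.keys q" "m = a + b"
  using assms keys_mult[of p q] by blast

lemma keys_diff_subset: "Poly_Mapping.keys (p - q) \<subseteq> Poly_Mapping.keys p \<union> Poly_Mapping.keys (q :: 'a \<Rightarrow>\<^sub>0 'b::ab_group_add)"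
  by (auto simp: in_keys_iff lookup_minus)

lemma poly_mapping_expand: "p = (\<Sum>m\<in>Poly_Mapping.keys p. Poly_Mapping.single m (Poly_Mapping.lookup p m))"
proof (rule poly_mapping_eqI)
  fix m
  have "(\<Sum>x\<in>Poly_Mapping.keys p. Poly_Mapping.lookup (Poly_Mapping.single x (Poly_Mapping.lookup p x)) m) = (\<Sum>x\<in>Poly_Mapping.keys p. if x = m then Poly_Mapping.lookup p m else 0)"
    by (rule sum.cong) (auto simp: lookup_single when_def)
  also have "\<dots> = Poly_Mapping.lookup p m" by (auto simp: sum.delta in_keys_iff)
  finally show "Poly_Mapping.lookup p m = Poly_Mapping.lookup (\<Sum>m\<in>Poly_Mapping.keys p. Poly_Mapping.single m (Poly_Mapping.lookup p m)) m" by (simp add: lookup_sum)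
qed

lemma subring_polyring: "subring_carrier (polyring N :: 'k::comm_ring_1 mpoly set)"
proof
  fix a b :: "'k mpoly" assume ab: "a \<in> polyring N" "b \<in> polyring N"
  show "a - b \<in> polyring N" using ab keys_diff_subset[of a b] unfolding polyring_def by blast
  have "1 \<le> i \<and> i \<le> N" if "m \<in> Poly_Mapping.keys (a * b)" "i \<in> Poly_Mapping.keys m" for m i
  proof -
    obtain u v where uv: "u \<in> Poly_Mapping.keys a" "v \<in> Poly_Mapping.keys b" "m = u + v" using keys_multE \<open>m \<in> _\<close> .
    then have "i \<in> Poly_Mapping.keys u \<or> i \<in> Poly_Mapping.keys v" using that(2) by (auto simp: in_keys_iff lookup_add)
    then show ?thesis using ab uv unfolding polyring_def by blast
  qed
  then show "a * b \<in> polyring N" by (simp add: polyring_def)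
qed (auto simp: polyring_def)

interpretation poly: truncated_ring "polyring N :: 'k::comm_ring_1 mpoly set" "trunc N" for N
proof (intro truncated_ring.intro subring_polyring truncated_ring_axioms.intro)
  fix a b :: "'k mpoly" and k
  show "a \<in> polyring N \<Longrightarrow> trunc N k a \<in> polyring N" by (auto simp: polyring_def keys_trunc)
  show "trunc N k (a + b) = trunc N k a + trunc N k b" by (rule trunc_add)
  show "trunc N 0 a = 0" by (rule trunc_eq_0) simp
  have "weight N m < Suc (Max (weight N ` Poly_Mapping.keys a))" if "m \<in> Poly_Mapping.keys a" for m
    using that by (simp add: le_imp_less_Suc)
  then show "\<exists>k. trunc N k a = a" using trunc_id by blast
qed

lemma homogeneousI:
  fixes f :: "'k::comm_ring_1 mpoly"
  assumes "\<And>m. m \<in> Poly_Mapping.keys f \<Longrightarrow> weight N m = d"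
  shows "poly.homogeneous N d f"
  unfolding poly.homogeneous_def
proof (intro allI)
  fix k and h :: "'k mpoly"
  \<comment> \<open>With \<open>h\<close> cut at degree k - d, the product of \<open>f\<close> with
    the lower part lies entirely below degree k, and the product with the rest entirely at or above
    it.\<close>
  define g where "g = trunc N (k - d) h"
  define r where "r = h - g"
  have "weight N m < k" if "m \<in> Poly_Mapping.keys (f * g)" for m
    using that by (auto elim!: keys_multE simp: g_def keys_trunc weight_add assms)
  then have 1: "trunc N k (f * g) = f * g" by (rule trunc_id)
  have r: "k - d \<le> weight N m" if "m \<in> Poly_Mapping.keys r" for m
    using that by (auto simp: r_def g_def in_keys_iff lookup_minus lookup_trunc when_def split: if_splits)
  have "k \<le> weight N m" if "m \<in> Poly_Mapping.keys (f * r)" for m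
    using that by (auto elim!: keys_multE dest!: r simp: weight_add assms)
  then have 2: "trunc N k (f * r) = 0" by (rule trunc_eq_0)
  have "f * h = f * g + f * r" by (simp add: r_def algebra_simps)
  then show "trunc N k (f * h) = f * trunc N (k - d) h"
    using 1 2 by (simp add: trunc_add flip: g_def)
qed

text \<open>Predicates on exponents replace generators: a polynomial lies in a monomial ideal iff
  all its monomials do, and colons and sums by variables become operations on \<open>Q\<close>. It
  is an ideal once \<open>Q\<close> is \<open>upward\<close>.\<close>

definition monomial_ideal :: "nat \<Rightarrow> ((nat \<Rightarrow> nat) \<Rightarrow> bool) \<Rightarrow> 'k::comm_ring_1 mpoly set" where
  "monomial_ideal N Q = {p \<in> polyring N. \<forall>m\<in>Poly_Mapping.keys p. Q (Poly_Mapping.lookup m)}"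

definition upward :: "((nat \<Rightarrow> nat) \<Rightarrow> bool) \<Rightarrow> bool" where
  "upward Q \<longleftrightarrow> (\<forall>u v. Q u \<longrightarrow> u \<le> v \<longrightarrow> Q v)"

lemma upwardD: "upward Q \<Longrightarrow> Q u \<Longrightarrow> u \<le> v \<Longrightarrow> Q v"
  by (auto simp: upward_def)

lemma upward_colon:
  assumes "upward Q" shows "upward (\<lambda>u. Q (u(i := Suc (u i))))"
  unfolding upward_def
proof (intro allI impI)
  fix u v :: "nat \<Rightarrow> nat" assume "Q (u(i := Suc (u i)))" "u \<le> v"
  then show "Q (v(i := Suc (v i)))"
    by (elim upwardD[OF assms]) (auto simp: le_fun_def)
qed

lemma upward_adjoin:
  assumes "upward Q" shows "upward (\<lambda>u. Q u \<or> 0 < u i)"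
  unfolding upward_def
proof (intro allI impI)
  fix u v :: "nat \<Rightarrow> nat" assume "Q u \<or> 0 < u i" "u \<le> v"
  then show "Q v \<or> 0 < v i" using upwardD[OF assms, of u v] le_funD[of u v i] by auto
qed

lemma is_ideal_monomial_ideal:
  assumes "upward Q"
  shows "poly.is_ideal N (monomial_ideal N Q :: 'k::comm_ring_1 mpoly set)"
proof (rule poly.is_idealI)
  fix a b :: "'k mpoly" assume ab: "a \<in> monomial_ideal N Q" "b \<in> monomial_ideal N Q"
  then show "a + b \<in> monomial_ideal N Q"
    using keys_add[of a b] poly.add_closed[of a N b] by (auto simp: monomial_ideal_def)
next
  fix r a :: "'k mpoly" assume ra: "r \<in> polyring N" "a \<in> monomial_ideal N Q"
  have "Q (Poly_Mapping.lookup m)" if "m \<in> Poly_Mapping.keys (r * a)" for m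
  proof -
    obtain u v where uv: "u \<in> Poly_Mapping.keys r" "v \<in> Poly_Mapping.keys a" "m = u + v" using keys_multE \<open>m \<in> _\<close> .
    then have "Q (Poly_Mapping.lookup v)" using ra by (auto simp: monomial_ideal_def)
    then show ?thesis by (rule upwardD[OF assms]) (simp add: uv le_fun_def lookup_add)
  qed
  then show "r * a \<in> monomial_ideal N Q" using ra by (auto simp: monomial_ideal_def poly.mult_closed)
qed (auto simp: monomial_ideal_def poly.zero_closed)

lemma T_stable_monomial_ideal: "poly.T_stable N (monomial_ideal N Q)"
  by (auto simp: poly.T_stable_def monomial_ideal_def keys_trunc poly.T_closed)

lemma single_in_monomial_ideal:
  "Poly_Mapping.keys m \<subseteq> {1..N} \<Longrightarrow> Q (Poly_Mapping.lookup m) \<Longrightarrow> Poly_Mapping.single m c \<in> monomial_ideal N Q"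
  by (auto simp: monomial_ideal_def polyring_def subset_iff)

lemma monomial_ideal_subsetI:
  fixes J :: "'k::comm_ring_1 mpoly set"
  assumes J: "poly.is_ideal N J"
    and "\<And>m c. Poly_Mapping.keys m \<subseteq> {1..N} \<Longrightarrow> Q (Poly_Mapping.lookup m) \<Longrightarrow> Poly_Mapping.single m c \<in> J"
  shows "monomial_ideal N Q \<subseteq> J"
proof
  fix p :: "'k mpoly" assume p: "p \<in> monomial_ideal N Q"
  have "(\<Sum>m\<in>Poly_Mapping.keys p. Poly_Mapping.single m (Poly_Mapping.lookup p m)) \<in> J"
  proof (rule poly.ideal_sum[OF J])
    fix m assume m: "m \<in> Poly_Mapping.keys p"
    then show "Poly_Mapping.single m (Poly_Mapping.lookup p m) \<in> J"
      using p by (intro assms(2)) (auto simp: monomial_ideal_def polyring_def subset_iff)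
  qed
  then show "p \<in> J" using poly_mapping_expand[of p] by simp
qed

lemma lookup_Var_mult: "Poly_Mapping.lookup (Var i * p) (Poly_Mapping.single i 1 + m) = Poly_Mapping.lookup p m"
proof -
  have eq: "(\<Sum>q. Poly_Mapping.lookup p q when Poly_Mapping.single i 1 + m = Poly_Mapping.single i 1 + q) = Poly_Mapping.lookup p m"
    by simp
  have "Poly_Mapping.lookup (Var i * p) (Poly_Mapping.single i 1 + m)
      = (\<Sum>l. (1 when Poly_Mapping.single i 1 = l) * (\<Sum>q. Poly_Mapping.lookup p q when Poly_Mapping.single i 1 + m = l + q))"
    by (simp add: Var_def lookup_mult lookup_single)
  also have "\<dots> = (\<Sum>l. (\<Sum>q. Poly_Mapping.lookup p q when Poly_Mapping.single i 1 + m = l + q) when Poly_Mapping.single i 1 = l)"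
    by (simp only: when_mult mult_1_left)
  also have "\<dots> = Poly_Mapping.lookup p m" using eq by simp
  finally show ?thesis .
qed

lemma Var_closed: "i \<in> {1..N} \<Longrightarrow> Var i \<in> polyring N"
  by (auto simp: Var_def polyring_def)

lemma homogeneous_Var: "i \<in> {1..N} \<Longrightarrow> poly.homogeneous N 1 (Var i)"
  by (rule homogeneousI) (auto simp: Var_def weight_def lookup_single when_def)

lemma lookup_single_add: "Poly_Mapping.lookup (Poly_Mapping.single i 1 + m) = (Poly_Mapping.lookup m)(i := Suc (Poly_Mapping.lookup m i))"
  by (rule ext) (auto simp: lookup_add lookup_single when_def)

text \<open>Multiplication by a variable maps distinct monomials to distinct monomials, so no terms
  cancel and membership can be tested monomial by monomial.\<close>

lemma colon_monomial_ideal: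
  assumes "i \<in> {1..N}"
  shows "poly.colon N (monomial_ideal N Q) (Var i) = monomial_ideal N (\<lambda>u. Q (u(i := Suc (u i))))"
proof (intro equalityI subsetI)
  fix p :: "'a mpoly" assume p: "p \<in> poly.colon N (monomial_ideal N Q) (Var i)"
  have "Q ((Poly_Mapping.lookup m)(i := Suc (Poly_Mapping.lookup m i)))" if "m \<in> Poly_Mapping.keys p" for m
  proof -
    have "Poly_Mapping.single i 1 + m \<in> Poly_Mapping.keys (Var i * p)" using that by (simp add: in_keys_iff lookup_Var_mult del: One_nat_def)
    then have "Q (Poly_Mapping.lookup (Poly_Mapping.single i 1 + m))" using p by (auto simp: poly.colon_def monomial_ideal_def)
    then show ?thesis by (simp only: lookup_single_add)
  qed
  then show "p \<in> monomial_ideal N (\<lambda>u. Q (u(i := Suc (u i))))"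
    using p by (auto simp: poly.colon_def monomial_ideal_def)
next
  fix p :: "'a mpoly" assume p: "p \<in> monomial_ideal N (\<lambda>u. Q (u(i := Suc (u i))))"
  have "Q (Poly_Mapping.lookup m)" if m: "m \<in> Poly_Mapping.keys (Var i * p)" for m
  proof -
    obtain u v where uv: "u \<in> Poly_Mapping.keys (Var i :: 'a mpoly)" "v \<in> Poly_Mapping.keys p" "m = u + v"
      using keys_multE[OF m] .
    then have v: "v \<in> Poly_Mapping.keys p" "m = Poly_Mapping.single i 1 + v"
      by (auto simp: Var_def split: if_splits)
    then have "Q ((Poly_Mapping.lookup v)(i := Suc (Poly_Mapping.lookup v i)))" using p by (auto simp: monomial_ideal_def)
    then show ?thesis by (simp only: v lookup_single_add)
  qed
  then show "p \<in> poly.colon N (monomial_ideal N Q) (Var i)"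
    using p poly.mult_closed[OF Var_closed[OF assms], of p]
    by (simp add: poly.colon_def monomial_ideal_def)
qed

lemma adjoin_monomial_ideal:
  assumes "upward Q" "i \<in> {1..N}"
  shows "poly.adjoin N (monomial_ideal N Q) (Var i) = (monomial_ideal N (\<lambda>u. Q u \<or> 0 < u i) :: 'k::comm_ring_1 mpoly set)"
proof
  note up = upward_adjoin[OF assms(1), of i]
  have "(Var i :: 'k mpoly) \<in> monomial_ideal N (\<lambda>u. Q u \<or> 0 < u i)"
    unfolding Var_def using assms by (intro single_in_monomial_ideal) auto
  then show "poly.adjoin N (monomial_ideal N Q) (Var i) \<subseteq> (monomial_ideal N (\<lambda>u. Q u \<or> 0 < u i) :: 'k mpoly set)"
    by (intro poly.adjoin_least is_ideal_monomial_ideal up) (auto simp: monomial_ideal_def)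
  note Q = is_ideal_monomial_ideal[OF assms(1)]
  show "(monomial_ideal N (\<lambda>u. Q u \<or> 0 < u i) :: 'k mpoly set) \<subseteq> poly.adjoin N (monomial_ideal N Q) (Var i)"
  proof (rule monomial_ideal_subsetI)
    show "poly.is_ideal N (poly.adjoin N (monomial_ideal N Q) (Var i) :: 'k mpoly set)"
      using Q Var_closed[OF assms(2)] by (rule poly.is_ideal_adjoin)
    fix m and c :: 'k assume m: "Poly_Mapping.keys m \<subseteq> {1..N}" "Q (Poly_Mapping.lookup m) \<or> 0 < Poly_Mapping.lookup m i"
    show "Poly_Mapping.single m c \<in> poly.adjoin N (monomial_ideal N Q) (Var i)"
    proof (cases "Q (Poly_Mapping.lookup m)")
      case True
      then show ?thesis using m by (intro poly.adjoin_superset single_in_monomial_ideal)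
    next
      case False
      \<comment> \<open>If \<open>Q\<close> fails, then x_i divides the monomial, so the truncated
        subtraction of exponents is exact.\<close>
      then have "Poly_Mapping.single i 1 + (m - Poly_Mapping.single i 1) = m"
        using m by (intro poly_mapping_eqI) (auto simp: lookup_add lookup_minus lookup_single when_def)
      then have "Poly_Mapping.single m c = Var i * Poly_Mapping.single (m - Poly_Mapping.single i 1) c" by (simp add: Var_def mult_single)
      moreover have "Poly_Mapping.single (m - Poly_Mapping.single i 1) c \<in> polyring N"
        using m by (auto simp: polyring_def in_keys_iff lookup_minus subset_iff split: if_splits)
      ultimately show ?thesis using poly.adjoin_generator[OF Q] by simp
    qed
  qed
qed

section \<open>Primes generated by variables\<close>

definition prime_ideal :: "nat \<Rightarrow> nat set \<Rightarrow> 'k::comm_ring_1 mpoly set" where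
  "prime_ideal N A = monomial_ideal N (\<lambda>u. \<exists>j\<in>A. 0 < u j)"

lemma upward_prime: "upward (\<lambda>u. \<exists>j\<in>A. 0 < u j)"
  unfolding upward_def le_fun_def by (meson less_le_trans)

lemma is_ideal_prime_ideal: "poly.is_ideal N (prime_ideal N A)"
  unfolding prime_ideal_def by (rule is_ideal_monomial_ideal[OF upward_prime])

lemma adjoin_prime_ideal: "i \<in> {1..N} \<Longrightarrow> poly.adjoin N (prime_ideal N A) (Var i) = prime_ideal N (insert i A)"
  unfolding prime_ideal_def by (simp add: adjoin_monomial_ideal[OF upward_prime] disj_commute)

lemma nonzerodivisor_Var:
  assumes "i \<in> {1..N}" "i \<notin> A"
  shows "poly.nonzerodivisor_mod N (prime_ideal N A) (Var i)"
  unfolding poly.nonzerodivisor_mod_def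
proof (intro ballI impI)
  fix g :: "'a mpoly" assume "g \<in> polyring N" "Var i * g \<in> prime_ideal N A"
  then have "g \<in> poly.colon N (prime_ideal N A) (Var i)" by (simp add: poly.colon_def)
  then have "g \<in> monomial_ideal N (\<lambda>u. \<exists>j\<in>A. 0 < (u(i := Suc (u i))) j)"
    by (simp only: colon_monomial_ideal[OF assms(1)] prime_ideal_def)
  moreover have "(\<lambda>u. \<exists>j\<in>A. 0 < (u(i := Suc (u i))) j) = (\<lambda>u. \<exists>j\<in>A. 0 < u j)"
    using assms(2) by (intro ext bex_cong) auto
  ultimately show "g \<in> prime_ideal N A" by (simp add: prime_ideal_def)
qed

section \<open>Elementary symmetric polynomials modulo these primes\<close>

definition esym :: "nat \<Rightarrow> nat \<Rightarrow> 'k::comm_ring_1 mpoly" where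
  "esym N d = (\<Sum>S\<in>{S. S \<subseteq> {1..N} \<and> card S = d}. \<Prod>i\<in>S. Var i)"

lemma prod_Var: "finite S \<Longrightarrow> (\<Prod>i\<in>S. Var i) = Poly_Mapping.single (\<Sum>i\<in>S. Poly_Mapping.single i 1) (1::'k::comm_ring_1)"
  by (induction S rule: finite_induct) (auto simp: Var_def mult_single)

lemma lookup_sum_single: "finite S \<Longrightarrow> Poly_Mapping.lookup (\<Sum>i\<in>S. Poly_Mapping.single i (Suc 0)) j = (if j \<in> S then 1 else (0::nat))"
  by (simp add: lookup_sum lookup_single when_def sum.delta)

lemma prod_Var_closed: "S \<subseteq> {1..N} \<Longrightarrow> (\<Prod>i\<in>S. Var i) \<in> monomial_ideal N (\<lambda>u. \<forall>i\<in>S. 0 < u i)"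
  using finite_subset[of S "{1..N}"]
  by (subst prod_Var)
    (auto simp: lookup_sum_single in_keys_iff subset_iff intro!: single_in_monomial_ideal split: if_splits)

lemma esym_homogeneous:
  "poly.homogeneous N d (esym N d :: 'k::comm_ring_1 mpoly)"
proof (rule homogeneousI)
  fix m assume "m \<in> Poly_Mapping.keys (esym N d :: 'k mpoly)"
  then obtain S where S: "S \<subseteq> {1..N}" "card S = d" "m \<in> Poly_Mapping.keys (\<Prod>i\<in>S. Var i :: 'k mpoly)"
    using keys_sum[of "\<lambda>S. \<Prod>i\<in>S. Var i :: 'k mpoly"] by (auto simp: esym_def)
  then have fin: "finite S" by (auto intro: finite_subset)
  then have "m = (\<Sum>i\<in>S. Poly_Mapping.single i 1)" using S(3) by (simp add: prod_Var split: if_splits)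
  then have "weight N m = card ({1..N} \<inter> S)"
    using fin by (simp add: weight_def lookup_sum_single sum.If_cases)
  then show "weight N m = d" using S by (simp add: Int_absorb1)
qed

lemma esym_in_monomial_ideal:
  assumes "0 < d"
  shows "esym N d \<in> monomial_ideal N (\<lambda>u. \<exists>i. 0 < u i)"
proof -
  have up: "upward (\<lambda>u. \<exists>i. 0 < u i)" using upward_prime[of UNIV] by simp
  have "(\<Prod>i\<in>S. Var i :: 'a mpoly) \<in> monomial_ideal N (\<lambda>u. \<exists>i. 0 < u i)"
    if "S \<subseteq> {1..N}" "card S = d" for S
  proof -
    have "S \<noteq> {}" using that assms by auto
    then show ?thesis using prod_Var_closed[OF that(1)] by (fastforce simp: monomial_ideal_def)
  qed
  then show ?thesis unfolding esym_def by (intro poly.ideal_sum[OF is_ideal_monomial_ideal[OF up]]) auto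
qed

lemma esym_closed: "esym N d \<in> polyring N"
proof -
  have "(\<Prod>i\<in>S. Var i :: 'a mpoly) \<in> polyring N" if "S \<subseteq> {1..N}" for S
    using prod_Var_closed[OF that] unfolding monomial_ideal_def by blast
  moreover have "poly.is_ideal N (polyring N)"
    by (rule poly.is_idealI) (auto intro: poly.zero_closed poly.add_closed poly.mult_closed)
  ultimately show ?thesis unfolding esym_def by (intro poly.ideal_sum) auto
qed

text \<open>Any other squarefree monomial of degree |F| contains a variable outside \<open>F\<close>
  and so vanishes modulo the prime; only the product over \<open>F\<close> survives.\<close>

lemma esym_top_prime_ideal:
  assumes "F \<subseteq> {1..N}"
  shows "(\<Prod>i\<in>F. Var i) - esym N (card F) \<in> (prime_ideal N ({1..N} - F) :: 'k::comm_ring_1 mpoly set)"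
proof -
  let ?C = "{S. S \<subseteq> {1..N} \<and> card S = card F}"
  have fin: "finite ?C" by (rule finite_subset[of _ "Pow {1..N}"]) auto
  have "esym N (card F) = (\<Prod>i\<in>F. Var i) + (\<Sum>S\<in>?C - {F}. \<Prod>i\<in>S. Var i :: 'k mpoly)"
    unfolding esym_def using assms by (subst sum.remove[OF fin, of F]) auto
  then have eq: "(\<Prod>i\<in>F. Var i) - esym N (card F) = - (\<Sum>S\<in>?C - {F}. \<Prod>i\<in>S. Var i :: 'k mpoly)"
    by simp
  have "(\<Prod>i\<in>S. Var i :: 'k mpoly) \<in> prime_ideal N ({1..N} - F)" if S: "S \<in> ?C - {F}" for S
  proof -
    have "\<not> S \<subseteq> F"
      using S card_subset_eq[OF finite_subset[OF assms], of S] by auto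
    then obtain j where "j \<in> S" "j \<in> {1..N} - F" using S by blast
    then show ?thesis using prod_Var_closed[of S N] S by (fastforce simp: prime_ideal_def monomial_ideal_def)
  qed
  then show ?thesis unfolding eq
    by (intro poly.ideal_uminus[OF is_ideal_prime_ideal] poly.ideal_sum[OF is_ideal_prime_ideal]) auto
qed

definition esyms :: "nat \<Rightarrow> nat \<Rightarrow> 'k::comm_ring_1 mpoly list" where
  "esyms N d = map (esym N) [1..<Suc d]"

lemma esyms_Suc: "esyms N (Suc d) = esyms N d @ [esym N (Suc d)]"
  by (simp add: esyms_def)

lemma esyms_closed: "set (esyms N d) \<subseteq> polyring N"
  by (auto simp: esyms_def esym_closed)

lemma nonzerodivisor_mod_prod:
  assumes "finite S" "S \<subseteq> {1..N}" "\<And>i. i \<in> S \<Longrightarrow> poly.nonzerodivisor_mod N J (Var i)"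
  shows "poly.nonzerodivisor_mod N J (\<Prod>i\<in>S. Var i)"
  using assms
proof (induction S rule: finite_induct)
  case (insert x S)
  have "(\<Prod>i\<in>S. Var i) \<in> polyring N"
    using prod_Var_closed[of S N] insert.prems by (auto simp only: monomial_ideal_def)
  moreover have "poly.nonzerodivisor_mod N J (Var x)" "poly.nonzerodivisor_mod N J (\<Prod>i\<in>S. Var i)"
    using insert by auto
  ultimately show ?case
    using insert.hyps by (auto simp: poly.nonzerodivisor_mod_def mult.assoc intro: poly.mult_closed)
qed (simp add: poly.nonzerodivisor_mod_def)

text \<open>Induction on the number of free variables. If d < |F|, kill one free variable, use the
  induction hypothesis, and move that variable behind the sequence. If d = |F|, the last member is
  congruent to the product of the free variables, each of which is regular after the first d - 1
  members.\<close>

lemma weakly_regular_esyms_prime_ideal: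
  assumes "F \<subseteq> {1..N}" "d \<le> card F"
  shows "poly.weakly_regular N (prime_ideal N ({1..N} - F)) (esyms N d :: 'k::comm_ring_1 mpoly list)"
  using assms
proof (induction "card F" arbitrary: F d rule: less_induct)
  case less
  have fin: "finite F" using less.prems finite_subset by auto
  let ?P = "prime_ideal N ({1..N} - F) :: 'k mpoly set"
  have P: "poly.is_ideal N ?P" by (rule is_ideal_prime_ideal)
  \<comment> \<open>Used with e = d when d < |F|, and with e = d - 1 when d = |F|. The bound e < |F|
    still leaves e free variables after x is killed.\<close>
  have *: "poly.weakly_regular N ?P (esyms N e) \<and>
      poly.nonzerodivisor_mod N (poly.adjoin_list N ?P (esyms N e)) (Var x :: 'k mpoly)"
    if "x \<in> F" "e < card F" for x e
  proof (rule poly.weakly_regular_permute[OF P])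
    have x: "x \<in> {1..N}" using that less.prems by auto
    show "poly.T_stable N ?P" unfolding prime_ideal_def by (rule T_stable_monomial_ideal)
    show "(Var x :: 'k mpoly) \<in> polyring N" "poly.homogeneous N 1 (Var x :: 'k mpoly)"
      using x by (rule Var_closed, rule homogeneous_Var)
    show "poly.nonzerodivisor_mod N ?P (Var x)" using x that by (intro nonzerodivisor_Var) auto
    have eq: "insert x ({1..N} - F) = {1..N} - (F - {x})" using x that by auto
    have "poly.weakly_regular N (prime_ideal N ({1..N} - (F - {x}))) (esyms N e :: 'k mpoly list)"
      using less.prems that fin by (intro less.hyps) (auto simp: card_Diff_singleton intro: psubset_card_mono)
    then show "poly.weakly_regular N (poly.adjoin N ?P (Var x)) (esyms N e)"
      by (simp only: adjoin_prime_ideal[OF x] eq)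
    show "f \<in> polyring N \<and> (\<exists>d. poly.homogeneous N d f)" if "f \<in> set (esyms N e)" for f :: "'k mpoly"
      using that esym_homogeneous esym_closed by (auto simp: esyms_def)
  qed simp
  show ?case
  proof (cases "d = card F")
    case False
    then have "d < card F" using less.prems by simp
    moreover from this obtain x where "x \<in> F" by (cases "F = {}") auto
    ultimately show ?thesis using * by blast
  next
    case True
    show ?thesis
    proof (cases d)
      case 0
      then show ?thesis by (simp add: esyms_def)
    next
      case (Suc e)
      then obtain x where x: "x \<in> F" using True by (cases "F = {}") auto
      let ?J = "poly.adjoin_list N ?P (esyms N e)"
      have J: "poly.is_ideal N ?J" by (rule poly.is_ideal_adjoin_list[OF P esyms_closed])
      have nz: "poly.nonzerodivisor_mod N ?J (\<Prod>i\<in>F. Var i)"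
        using * True Suc less.prems fin by (intro nonzerodivisor_mod_prod) auto
      have diff: "(\<Prod>i\<in>F. Var i) - esym N d \<in> ?J"
        using esym_top_prime_ideal[OF less.prems(1)] poly.adjoin_list_superset[of ?P N] True by blast
      have "poly.nonzerodivisor_mod N ?J (esym N d)"
        unfolding poly.nonzerodivisor_mod_def
      proof (intro ballI impI)
        fix g :: "'k mpoly" assume g: "g \<in> polyring N" "esym N d * g \<in> ?J"
        have "(\<Prod>i\<in>F. Var i) * g = ((\<Prod>i\<in>F. Var i) - esym N d) * g + esym N d * g"
          by (simp add: algebra_simps)
        also have "\<dots> \<in> ?J" by (rule poly.ideal_add[OF J poly.ideal_mult_right[OF J diff g(1)] g(2)])
        finally show "g \<in> ?J" using nz g by (auto dest: poly.nonzerodivisor_modD)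
      qed
      then show ?thesis
        using *[OF x, of e] True
        by (simp add: Suc esyms_Suc poly.weakly_regular_append del: One_nat_def flip: True)
    qed
  qed
qed

section \<open>Splitting monomial ideals by variables\<close>

text \<open>A predicate \<open>Q\<close> on exponent vectors stands for the ideal \<open>J\<close> spanned by the monomials satisfying it.
  The last two premises of \<open>split\<close> then speak about \<open>J : x\<^sub>i\<close> and \<open>(J, x\<^sub>i)\<close>.\<close>

inductive filtered :: "nat \<Rightarrow> nat \<Rightarrow> ((nat \<Rightarrow> nat) \<Rightarrow> bool) \<Rightarrow> bool" for N d :: nat where
  unit: "filtered N d (\<lambda>u. True)"
| prime: "A \<subseteq> {1..N} \<Longrightarrow> d + card A \<le> N \<Longrightarrow> filtered N d (\<lambda>u. \<exists>j\<in>A. 0 < u j)"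
| split: "i \<in> {1..N} \<Longrightarrow> filtered N d (\<lambda>u. Q (u(i := Suc (u i)))) \<Longrightarrow>
    filtered N d (\<lambda>u. Q u \<or> 0 < u i) \<Longrightarrow> filtered N d Q"

text \<open>\<open>A\<close> records the variables already killed. By
  \<open>filtered_over_cong\<close>, \<open>Q\<close> matters only where they vanish, so it can be
  simplified after each split without carrying the disjunction along.\<close>

definition filtered_over :: "nat \<Rightarrow> nat \<Rightarrow> nat set \<Rightarrow> ((nat \<Rightarrow> nat) \<Rightarrow> bool) \<Rightarrow> bool" where
  "filtered_over N d A Q \<longleftrightarrow> filtered N d (\<lambda>u. (\<exists>j\<in>A. 0 < u j) \<or> Q u)"

lemma filtered_over_cong:
  assumes "\<And>u. (\<And>j. j \<in> A \<Longrightarrow> u j = 0) \<Longrightarrow> Q u \<longleftrightarrow> Q' u"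
  shows "filtered_over N d A Q \<longleftrightarrow> filtered_over N d A Q'"
proof -
  have "(\<lambda>u. (\<exists>j\<in>A. 0 < u j) \<or> Q u) = (\<lambda>u. (\<exists>j\<in>A. 0 < u j) \<or> Q' u)"
  proof
    fix u :: "nat \<Rightarrow> nat"
    show "((\<exists>j\<in>A. 0 < u j) \<or> Q u) = ((\<exists>j\<in>A. 0 < u j) \<or> Q' u)"
      using assms[of u] by (cases "\<exists>j\<in>A. 0 < u j") auto
  qed
  then show ?thesis by (simp add: filtered_over_def)
qed

lemma filtered_over_insert_cong:
  assumes "filtered_over N d (insert k A) Q'" "\<And>u. u k = 0 \<Longrightarrow> Q u \<longleftrightarrow> Q' u"
  shows "filtered_over N d (insert k A) Q"
  using assms filtered_over_cong[of "insert k A" Q Q'] by blast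

lemma filtered_over_unit:
  assumes "\<And>u. (\<And>j. j \<in> A \<Longrightarrow> u j = 0) \<Longrightarrow> Q u"
  shows "filtered_over N d A Q"
proof -
  have "filtered_over N d A (\<lambda>u. True)" unfolding filtered_over_def by (simp add: filtered.unit)
  then show ?thesis using filtered_over_cong[of A Q "\<lambda>u. True"] assms by blast
qed

lemma filtered_over_prime:
  assumes "A \<subseteq> {1..N}" "d + card A \<le> N" "\<And>u. (\<And>j. j \<in> A \<Longrightarrow> u j = 0) \<Longrightarrow> \<not> Q u"
  shows "filtered_over N d A Q"
proof -
  have "filtered_over N d A (\<lambda>u. False)"
    unfolding filtered_over_def using filtered.prime[OF assms(1,2)] by simp
  then show ?thesis using filtered_over_cong[of A Q "\<lambda>u. False"] assms by blast
qed

lemma filtered_over_split: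
  assumes "i \<in> {1..N}" "i \<notin> A"
    and "filtered_over N d A (\<lambda>u. Q (u(i := Suc (u i))))" "filtered_over N d (insert i A) Q"
  shows "filtered_over N d A Q"
  unfolding filtered_over_def
proof (rule filtered.split[OF assms(1)])
  have "(\<exists>j\<in>A. 0 < (u(i := Suc (u i))) j) \<longleftrightarrow> (\<exists>j\<in>A. 0 < u j)" for u
    using assms(2) by (intro bex_cong) auto
  then show "filtered N d (\<lambda>u. (\<exists>j\<in>A. 0 < (u(i := Suc (u i))) j) \<or> Q (u(i := Suc (u i))))"
    using assms(3) by (simp only: filtered_over_def)
  have "(\<lambda>u. ((\<exists>j\<in>A. 0 < u j) \<or> Q u) \<or> 0 < u i) = (\<lambda>u. (\<exists>j\<in>insert i A. 0 < u j) \<or> Q u)"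
    by (rule ext) auto
  then show "filtered N d (\<lambda>u. ((\<exists>j\<in>A. 0 < u j) \<or> Q u) \<or> 0 < u i)"
    using assms(4) by (simp only: filtered_over_def)
qed

lemma le_Suc_iff_pred_le: "x \<le> Suc y \<longleftrightarrow> x - 1 \<le> y"
  by arith

text \<open>Strip the monomial x_i^p x_j^q one variable at a time until the unit ideal is left. Each
  killed variable annihilates the monomial and leaves a prime with one generator more than |A|;
  hence the 1 in the budget.\<close>

lemma filtered_over_principal:
  assumes "A \<subseteq> {1..N}" "d + card A + 1 \<le> N" "i \<in> {1..N} - A" "j \<in> {1..N} - A" "i \<noteq> j"
  shows "filtered_over N d A (\<lambda>u. p \<le> u i \<and> q \<le> u j)"
proof (induction "p + q" arbitrary: p q)
  case 0
  then show ?case by (intro filtered_over_unit) auto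
next
  case (Suc x)
  have fin: "finite A" using assms finite_subset by blast
  have prime: "filtered_over N d (insert k A) Q"
    if "k \<in> {i, j}" "\<And>u. u k = 0 \<Longrightarrow> \<not> Q u" for k Q
    using that assms fin by (intro filtered_over_prime) auto
  show ?case
  proof (cases p)
    case (Suc p')
    have "filtered_over N d A (\<lambda>u. p' \<le> u i \<and> q \<le> u j)" using Suc.hyps Suc by simp
    moreover have "(p \<le> (u(i := Suc (u i))) i \<and> q \<le> (u(i := Suc (u i))) j) = (p' \<le> u i \<and> q \<le> u j)" for u :: "nat \<Rightarrow> nat"
      using Suc assms(5) by auto
    ultimately have "filtered_over N d A (\<lambda>u. p \<le> (u(i := Suc (u i))) i \<and> q \<le> (u(i := Suc (u i))) j)"
      by (simp only:)
    moreover have "filtered_over N d (insert i A) (\<lambda>u. p \<le> u i \<and> q \<le> u j)"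
      using Suc by (intro prime) auto
    ultimately show ?thesis
      using filtered_over_split[of i N A d "\<lambda>u. p \<le> u i \<and> q \<le> u j"] assms(3) by blast
  next
    case 0
    then obtain q' where q': "q = Suc q'" using Suc.hyps(2) by (cases q) auto
    have "filtered_over N d A (\<lambda>u. p \<le> u i \<and> q' \<le> u j)" using Suc.hyps q' by simp
    moreover have "(p \<le> (u(j := Suc (u j))) i \<and> q \<le> (u(j := Suc (u j))) j) = (p \<le> u i \<and> q' \<le> u j)" for u :: "nat \<Rightarrow> nat"
      using q' assms(5) by auto
    ultimately have "filtered_over N d A (\<lambda>u. p \<le> (u(j := Suc (u j))) i \<and> q \<le> (u(j := Suc (u j))) j)"
      by (simp only:)
    moreover have "filtered_over N d (insert j A) (\<lambda>u. p \<le> u i \<and> q \<le> u j)"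
      using q' by (intro prime) auto
    ultimately show ?thesis
      using filtered_over_split[of j N A d "\<lambda>u. p \<le> u i \<and> q \<le> u j"] assms(4) by blast
  qed
qed

text \<open>The predicate describes \<open>((x\<^sub>i x\<^sub>j)\<^sup>a, x\<^sub>j x\<^sub>k)\<^sup>t\<close>.\<close>

lemma filtered_over_three_path:
  assumes "A \<subseteq> {1..N}" "d + card A + 2 \<le> N"
    and ijk: "i \<in> {1..N} - A" "j \<in> {1..N} - A" "k \<in> {1..N} - A" "i \<noteq> j" "i \<noteq> k" "j \<noteq> k" and "a \<ge> 1"
  shows "filtered_over N d A (\<lambda>u. \<exists>s r. s + r = t \<and> a * s \<le> u i \<and> a * s + r \<le> u j \<and> r \<le> u k)"
proof (induction t)
  case 0
  then show ?case by (intro filtered_over_unit) auto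
next
  case (Suc t)
  let ?Q = "\<lambda>t u. \<exists>s r. s + r = t \<and> a * s \<le> u i \<and> a * s + r \<le> u j \<and> r \<le> u k"
  have fin: "finite A" using assms finite_subset by blast
  have colon: "?Q (Suc t) (u(j := Suc (u j), k := Suc (u k))) \<longleftrightarrow> ?Q t u" for u
  proof
    assume "?Q (Suc t) (u(j := Suc (u j), k := Suc (u k)))"
    then obtain s r where sr: "s + r = Suc t" "a * s \<le> u i" "a * s + r \<le> Suc (u j)" "r \<le> Suc (u k)"
      using ijk by auto
    show "?Q t u"
    proof (cases r)
      case 0
      then have "a * t + a = a * s" using sr by auto
      then show ?thesis using sr 0 \<open>a \<ge> 1\<close> by (intro exI[of _ t] exI[of _ 0]) auto
    next
      case (Suc r')
      then show ?thesis using sr by (intro exI[of _ s] exI[of _ r']) auto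
    qed
  next
    assume "?Q t u"
    then obtain s r where "s + r = t" "a * s \<le> u i" "a * s + r \<le> u j" "r \<le> u k" by blast
    then show "?Q (Suc t) (u(j := Suc (u j), k := Suc (u k)))"
      using ijk by (intro exI[of _ s] exI[of _ "Suc r"]) auto
  qed
  \<comment> \<open>Killing x_k forces r = 0 and leaves a principal ideal; the exponent of x_j is
    one lower because of the colon by x_j.\<close>
  have "filtered_over N d (insert k A) (\<lambda>u. a * Suc t \<le> u i \<and> a * Suc t - 1 \<le> u j)"
    using assms fin by (intro filtered_over_principal) auto
  moreover have "?Q (Suc t) (u(j := Suc (u j))) \<longleftrightarrow> a * Suc t \<le> u i \<and> a * Suc t - 1 \<le> u j" if "u k = 0" for u
  proof -
    have "?Q (Suc t) (u(j := Suc (u j))) \<longleftrightarrow> a * Suc t \<le> u i \<and> a * Suc t \<le> Suc (u j)"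
      using that ijk by (auto simp del: mult_Suc_right)
    then show ?thesis by (simp only: le_Suc_iff_pred_le)
  qed
  ultimately have plus: "filtered_over N d (insert k A) (\<lambda>u. ?Q (Suc t) (u(j := Suc (u j))))"
    by (rule filtered_over_insert_cong)
  show ?case
  proof (rule filtered_over_split[of j])
    show "filtered_over N d A (\<lambda>u. ?Q (Suc t) (u(j := Suc (u j))))"
    proof (rule filtered_over_split[of k])
      have "u(k := Suc (u k), j := Suc ((u(k := Suc (u k))) j)) = u(j := Suc (u j), k := Suc (u k))" for u
        using ijk by auto
      then show "filtered_over N d A (\<lambda>u. ?Q (Suc t) (u(k := Suc (u k), j := Suc ((u(k := Suc (u k))) j))))"
        using Suc by (simp only: colon)
    qed (use ijk plus in auto)
    show "filtered_over N d (insert j A) (?Q (Suc t))"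
      using assms fin by (intro filtered_over_prime) auto
  qed (use ijk in auto)
qed

text \<open>The predicate describes \<open>((x\<^sub>i x\<^sub>j)\<^sup>a, x\<^sub>k x\<^sub>l)\<^sup>t : x\<^sub>j\<close>.\<close>

lemma filtered_over_complete_intersection:
  assumes "A \<subseteq> {1..N}" "d + card A + 2 \<le> N"
    and ijkl: "i \<in> {1..N} - A" "j \<in> {1..N} - A" "k \<in> {1..N} - A" "l \<in> {1..N} - A"
      "distinct [i, j, k, l]"
  shows "filtered_over N d A (\<lambda>u. \<exists>s r. s + r = t \<and> a * s \<le> u i \<and> a * s \<le> Suc (u j) \<and> r \<le> u k \<and> r \<le> u l)"
proof (induction t)
  case 0
  then show ?case by (intro filtered_over_unit) auto
next
  case (Suc t)
  let ?Q = "\<lambda>t u. \<exists>s r. s + r = t \<and> a * s \<le> u i \<and> a * s \<le> Suc (u j) \<and> r \<le> u k \<and> r \<le> u l"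
  have fin: "finite A" using assms finite_subset by blast
  have colon: "?Q (Suc t) (u(k := Suc (u k), l := Suc (u l))) \<longleftrightarrow> ?Q t u" for u
  proof
    assume "?Q (Suc t) (u(k := Suc (u k), l := Suc (u l)))"
    then obtain s r where sr: "s + r = Suc t" "a * s \<le> u i" "a * s \<le> Suc (u j)" "r \<le> Suc (u k)" "r \<le> Suc (u l)"
      using ijkl by auto
    show "?Q t u"
    proof (cases r)
      case 0
      then have "a * t \<le> a * s" using sr by auto
      then show ?thesis using sr 0 by (intro exI[of _ t] exI[of _ 0]) auto
    next
      case (Suc r')
      then show ?thesis using sr by (intro exI[of _ s] exI[of _ r']) auto
    qed
  next
    assume "?Q t u"
    then obtain s r where "s + r = t" "a * s \<le> u i" "a * s \<le> Suc (u j)" "r \<le> u k" "r \<le> u l" by blast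
    then show "?Q (Suc t) (u(k := Suc (u k), l := Suc (u l)))"
      using ijkl by (intro exI[of _ s] exI[of _ "Suc r"]) auto
  qed
  \<comment> \<open>Killing either end of the light edge forces r = 0 and leaves the same principal
    ideal, again lowered by one at x_j.\<close>
  have plus: "filtered_over N d (insert x A) Q"
    if x: "x \<in> {k, l}" and Q: "\<And>u. u x = 0 \<Longrightarrow> Q u \<longleftrightarrow> a * Suc t \<le> u i \<and> a * Suc t - 1 \<le> u j" for x Q
  proof -
    have "x \<in> {1..N} - A" "x \<noteq> i" "x \<noteq> j" "i \<noteq> j" using x ijkl by auto
    moreover from this have "card (insert x A) = Suc (card A)" using fin by simp
    ultimately have "filtered_over N d (insert x A) (\<lambda>u. a * Suc t \<le> u i \<and> a * Suc t - 1 \<le> u j)"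
      using assms(1,2) ijkl(1,2) by (intro filtered_over_principal) auto
    then show ?thesis using Q by (rule filtered_over_insert_cong)
  qed
  show ?case
  proof (rule filtered_over_split[of k])
    show "filtered_over N d A (\<lambda>u. ?Q (Suc t) (u(k := Suc (u k))))"
    proof (rule filtered_over_split[of l])
      have "u(l := Suc (u l), k := Suc ((u(l := Suc (u l))) k)) = u(k := Suc (u k), l := Suc (u l))" for u
        using ijkl by auto
      then show "filtered_over N d A (\<lambda>u. ?Q (Suc t) (u(l := Suc (u l), k := Suc ((u(l := Suc (u l))) k))))"
        using Suc by (simp only: colon)
      show "filtered_over N d (insert l A) (\<lambda>u. ?Q (Suc t) (u(k := Suc (u k))))"
      proof (rule plus)
        fix u :: "nat \<Rightarrow> nat" assume "u l = 0"
        then have "?Q (Suc t) (u(k := Suc (u k))) \<longleftrightarrow> a * Suc t \<le> u i \<and> a * Suc t \<le> Suc (u j)"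
          using ijkl by (auto simp del: mult_Suc_right)
        then show "?Q (Suc t) (u(k := Suc (u k))) \<longleftrightarrow> a * Suc t \<le> u i \<and> a * Suc t - 1 \<le> u j"
          by (simp only: le_Suc_iff_pred_le)
      qed simp
    qed (use ijkl in auto)
    show "filtered_over N d (insert k A) (?Q (Suc t))"
    proof (rule plus)
      fix u :: "nat \<Rightarrow> nat" assume "u k = 0"
      then have "?Q (Suc t) u \<longleftrightarrow> a * Suc t \<le> u i \<and> a * Suc t \<le> Suc (u j)"
        by (auto simp del: mult_Suc_right)
      then show "?Q (Suc t) u \<longleftrightarrow> a * Suc t \<le> u i \<and> a * Suc t - 1 \<le> u j" by (simp only: le_Suc_iff_pred_le)
    qed simp
  qed (use ijkl in auto)
qed

section \<open>From splittings by variables to regular sequences\<close>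

text \<open>Membership of \<open>x\<^sup>u\<close> in the \<open>t\<close>-th power of the path ideal on \<open>n\<close> vertices; \<open>c i\<close> counts how often the
  generator of the edge \<open>{i, i + 1}\<close> is used.\<close>

lemma weakly_regular_esyms:
  assumes "filtered N d Q" "upward Q"
  shows "poly.weakly_regular N (monomial_ideal N Q) (esyms N d :: 'k::comm_ring_1 mpoly list)"
  using assms
proof (induction rule: filtered.induct)
  case unit
  then show ?case by (intro poly.weakly_regular_unit) (simp add: monomial_ideal_def)
next
  case (prime A)
  have "{1..N} - ({1..N} - A) = A" "d \<le> card ({1..N} - A)"
    using prime finite_subset[of A "{1..N}"] by (auto simp: card_Diff_subset)
  then show ?case
    using weakly_regular_esyms_prime_ideal[of "{1..N} - A" N d] by (simp add: prime_ideal_def)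
next
  case (split i Q)
  show ?case
  proof (rule poly.weakly_regular_split[of N _ "Var i"])
    \<comment> \<open>Both pieces are again given by upward predicates, as the induction hypotheses
      require.\<close>
    show "poly.weakly_regular N (poly.colon N (monomial_ideal N Q) (Var i)) (esyms N d :: 'k mpoly list)"
      using split upward_colon by (simp only: colon_monomial_ideal)
    show "poly.weakly_regular N (poly.adjoin N (monomial_ideal N Q) (Var i)) (esyms N d :: 'k mpoly list)"
      using split upward_adjoin by (simp only: adjoin_monomial_ideal)
  qed (use split in \<open>auto intro: is_ideal_monomial_ideal Var_closed simp: esyms_closed\<close>)
qed

section \<open>Powers of weighted path ideals\<close>

text \<open>Setting \<open>c\<close> to zero at 0 and from \<open>n\<close> on gives the end
  vertices the same inequality as the inner ones: vertex \<open>Suc i\<close> lies on edges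
  \<open>i\<close> and \<open>Suc i\<close>. The slack in the inequalities is the cofactor
  monomial.\<close>

definition path_power :: "(nat \<Rightarrow> nat) \<Rightarrow> nat \<Rightarrow> nat \<Rightarrow> (nat \<Rightarrow> nat) \<Rightarrow> bool" where
  "path_power w n t u \<longleftrightarrow> (\<exists>c. (\<forall>i. i = 0 \<or> n \<le> i \<longrightarrow> c i = 0) \<and> (\<Sum>i<n. c i) = t \<and>
     (\<forall>i. w i * c i + w (Suc i) * c (Suc i) \<le> u (Suc i)))"

lemma path_powerI:
  assumes "\<And>i. i = 0 \<or> n \<le> i \<Longrightarrow> c i = 0" "(\<Sum>i<n. c i) = t"
    "\<And>i. w i * c i + w (Suc i) * c (Suc i) \<le> u (Suc i)"
  shows "path_power w n t u"
  using assms unfolding path_power_def by blast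

lemma path_powerE:
  assumes "path_power w n t u"
  obtains c where "\<And>i. i = 0 \<or> n \<le> i \<Longrightarrow> c i = 0" "(\<Sum>i<n. c i) = t"
    "\<And>i. w i * c i + w (Suc i) * c (Suc i) \<le> u (Suc i)"
  using assms unfolding path_power_def by blast

lemma path_power_0: "path_power w n 0 u"
  by (rule path_powerI[of _ "\<lambda>i. 0"]) auto

lemma path_power_local: "(\<And>i. i \<le> n \<Longrightarrow> u i \<le> v i) \<Longrightarrow> path_power w n t u \<Longrightarrow> path_power w n t v"
proof (erule path_powerE)
  fix c assume uv: "\<And>i. i \<le> n \<Longrightarrow> u i \<le> v i"
    and c: "\<And>i. i = 0 \<or> n \<le> i \<Longrightarrow> c i = 0" "(\<Sum>i<n. c i) = t"
      "\<And>i. w i * c i + w (Suc i) * c (Suc i) \<le> u (Suc i)"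
  show "path_power w n t v"
  proof (rule path_powerI[OF c(1,2)])
    fix i show "w i * c i + w (Suc i) * c (Suc i) \<le> v (Suc i)"
      using c(1)[of i] c(1)[of "Suc i"] c(3)[of i] uv[of "Suc i"] by (cases "Suc i \<le> n") auto
  qed
qed

lemma path_power_mono: "path_power w n t u \<Longrightarrow> u \<le> v \<Longrightarrow> path_power w n t v"
  using path_power_local[of n u v] by (simp add: le_fun_def)

text \<open>Edge \<open>m\<close> has positive weight, so it cannot be used when an exponent at one
  of its ends is zero. For m = 0 there is no such edge.\<close>

lemma path_power_restrict:
  assumes "u m = 0 \<or> u (Suc m) = 0" "m > 0 \<Longrightarrow> w m > 0"
  shows "path_power w (Suc m) t u \<longleftrightarrow> path_power w m t u"
proof
  assume "path_power w (Suc m) t u"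
  then obtain c where c: "\<And>i. i = 0 \<or> Suc m \<le> i \<Longrightarrow> c i = 0" "(\<Sum>i<Suc m. c i) = t"
      "\<And>i. w i * c i + w (Suc i) * c (Suc i) \<le> u (Suc i)" by (rule path_powerE) blast
  have "c m = 0"
  proof (cases m)
    case 0 then show ?thesis using c(1) by simp
  next
    case (Suc l)
    then show ?thesis using assms c(3)[of l] c(3)[of m] by auto
  qed
  then have "\<And>i. i = 0 \<or> m \<le> i \<Longrightarrow> c i = 0" using c(1) by (metis le_neq_implies_less not_less_eq_eq not_less)
  then show "path_power w m t u" using c \<open>c m = 0\<close> by (intro path_powerI[of _ c]) auto
next
  assume "path_power w m t u"
  then obtain c where "\<And>i. i = 0 \<or> m \<le> i \<Longrightarrow> c i = 0" "(\<Sum>i<m. c i) = t"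
      "\<And>i. w i * c i + w (Suc i) * c (Suc i) \<le> u (Suc i)" by (rule path_powerE) blast
  then show "path_power w (Suc m) t u" by (intro path_powerI[of _ c]) auto
qed

text \<open>Stated with the old value on the left to avoid truncated subtraction.\<close>

lemma sum_upd: "(k::nat) < n \<Longrightarrow> (\<Sum>i<n. (c(k := v)) i) + c k = (\<Sum>i<n. c i) + (v :: nat)"
proof -
  assume "k < n"
  then have "sum f {..<n} = f k + sum f ({..<n} - {k})" for f :: "nat \<Rightarrow> nat"
    by (intro sum.remove) auto
  moreover have "sum (c(k := v)) ({..<n} - {k}) = sum c ({..<n} - {k})" by (rule sum.cong) auto
  ultimately show ?thesis by (metis add.commute add.left_commute fun_upd_same)
qed

lemma path_power_remove_edge:
  assumes c: "\<And>i. i = 0 \<or> n \<le> i \<Longrightarrow> c i = 0" "(\<Sum>i<n. c i) = Suc t"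
    and k: "c k > 0"
    and le: "\<And>i. w i * (c(k := c k - 1)) i + w (Suc i) * (c(k := c k - 1)) (Suc i) \<le> u (Suc i)"
  shows "path_power w n t u"
proof (rule path_powerI[where c = "c(k := c k - 1)"])
  have "\<not> (k = 0 \<or> n \<le> k)" using c(1)[of k] k by (metis less_irrefl)
  then have kn: "0 < k" "k < n" by auto
  show "(c(k := c k - 1)) i = 0" if "i = 0 \<or> n \<le> i" for i
    using c(1)[OF that] k by (cases "i = k") auto
  fix i
  show "w i * (c(k := c k - 1)) i + w (Suc i) * (c(k := c k - 1)) (Suc i) \<le> u (Suc i)" by (rule le)
  show "(\<Sum>i<n. (c(k := c k - 1)) i) = t" using sum_upd[OF kn(2), of c "c k - 1"] k c(2) by simp
qed

lemma path_power_add_edge: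
  assumes "path_power w n t u" "1 \<le> k" "k < n"
    and "\<And>i. u i + (if i = k \<or> i = Suc k then w k else 0) \<le> v i"
  shows "path_power w n (Suc t) v"
proof -
  from assms(1) obtain c where c: "\<And>i. i = 0 \<or> n \<le> i \<Longrightarrow> c i = 0" "(\<Sum>i<n. c i) = t"
      "\<And>i. w i * c i + w (Suc i) * c (Suc i) \<le> u (Suc i)" by (rule path_powerE) blast
  show ?thesis
  proof (rule path_powerI)
    show "(c(k := Suc (c k))) i = 0" if "i = 0 \<or> n \<le> i" for i
      using c(1)[OF that] assms(2,3) that by auto
    fix i
    show "(\<Sum>i<n. (c(k := Suc (c k))) i) = Suc t" using sum_upd[OF assms(3), of c "Suc (c k)"] c(2) by simp
    show "w i * (c(k := Suc (c k))) i + w (Suc i) * (c(k := Suc (c k))) (Suc i) \<le> v (Suc i)"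
      using c(3)[of i] assms(4)[of "Suc i"] by (auto split: if_splits)
  qed
qed

lemma path_power_add:
  assumes "path_power w n s u" "path_power w n t v"
  shows "path_power w n (s + t) (\<lambda>i. u i + v i)"
proof -
  from assms(1) obtain c where c: "\<And>i. i = 0 \<or> n \<le> i \<Longrightarrow> c i = 0" "(\<Sum>i<n. c i) = s"
      "\<And>i. w i * c i + w (Suc i) * c (Suc i) \<le> u (Suc i)" by (rule path_powerE) blast
  from assms(2) obtain e where e: "\<And>i. i = 0 \<or> n \<le> i \<Longrightarrow> e i = 0" "(\<Sum>i<n. e i) = t"
      "\<And>i. w i * e i + w (Suc i) * e (Suc i) \<le> v (Suc i)" by (rule path_powerE) blast
  show ?thesis
  proof (rule path_powerI[of _ "\<lambda>i. c i + e i"])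
    fix i show "w i * (c i + e i) + w (Suc i) * (c (Suc i) + e (Suc i)) \<le> u (Suc i) + v (Suc i)"
      using c(3)[of i] e(3)[of i] by (simp add: algebra_simps)
  qed (use c e in \<open>auto simp: sum.distrib\<close>)
qed

text \<open>Between two heavy edges the cancelled generator need not occur in the given product; the exchange
  \<open>f\<^sub>j f\<^sub>j\<^sub>+\<^sub>2 \<in> (f\<^sub>j\<^sub>+\<^sub>1\<^sup>2)\<close> then makes it occur.\<close>

lemma path_power_colon_edge:
  assumes k: "Suc j < n" and w: "w (Suc j) = 1"
    and ends: "n = Suc (Suc j) \<or> j = 0 \<or> (w j \<ge> 2 \<and> w (Suc (Suc j)) \<ge> 2)"
  shows "path_power w n (Suc t) (u(Suc j := Suc (u (Suc j)), Suc (Suc j) := Suc (u (Suc (Suc j)))))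
    \<longleftrightarrow> path_power w n t u" (is "path_power w n _ ?v \<longleftrightarrow> _")
proof
  assume "path_power w n t u"
  then show "path_power w n (Suc t) ?v"
    by (rule path_power_add_edge[where k = "Suc j"]) (use k w in auto)
next
  assume "path_power w n (Suc t) ?v"
  then obtain c where c: "\<And>i. i = 0 \<or> n \<le> i \<Longrightarrow> c i = 0" "(\<Sum>i<n. c i) = Suc t"
      "\<And>i. w i * c i + w (Suc i) * c (Suc i) \<le> ?v (Suc i)" by (rule path_powerE) blast
  have other: "w i * c i + w (Suc i) * c (Suc i) \<le> u (Suc i)" if "i \<noteq> j" "i \<noteq> Suc j" for i
    using c(3)[of i] that by simp
  have left: "w j * c j + c (Suc j) \<le> Suc (u (Suc j))"
    using c(3)[of j] w by simp
  have right: "c (Suc j) + w (Suc (Suc j)) * c (Suc (Suc j)) \<le> Suc (u (Suc (Suc j)))"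
    using c(3)[of "Suc j"] w by simp
  have remove: "path_power w n t u"
    if "c k > 0" "\<And>i. w i * (c(k := c k - 1)) i + w (Suc i) * (c(k := c k - 1)) (Suc i) \<le> u (Suc i)" for k
    using c(1,2) that by (rule path_power_remove_edge)
  have dec: "w i * (c i - 1) \<le> w i * c i" for i by simp
  have decr: "x + w i * (c i - 1) \<le> y" if "x + w i * c i \<le> y" for i x y
    using that dec[of i] by linarith
  have decl: "w i * (c i - 1) + x \<le> y" if "w i * c i + x \<le> y" for i x y
    using that dec[of i] by linarith
  have dec1: "w i * (c i - 1) \<le> x" if "w i * c i \<le> Suc x" "0 < c i" for i x
    using that by (cases "w i"; cases "c i") auto
  show "path_power w n t u"
  proof (cases "c (Suc j) = 0")
    case False
    show ?thesis
    proof (rule remove[of "Suc j"])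
      fix i show "w i * (c(Suc j := c (Suc j) - 1)) i + w (Suc i) * (c(Suc j := c (Suc j) - 1)) (Suc i) \<le> u (Suc i)"
        using other[of i] left right w False by auto
    qed (use False in auto)
  next
    case j0: True
    consider (both) "0 < c j" "0 < c (Suc (Suc j))" | (l) "0 < c j" "c (Suc (Suc j)) = 0"
      | (r) "c j = 0" "0 < c (Suc (Suc j))" | (none) "c j = 0" "c (Suc (Suc j)) = 0" by auto
    then show ?thesis
    proof cases
      case l
      show ?thesis
      proof (rule remove[of j])
        fix i show "w i * (c(j := c j - 1)) i + w (Suc i) * (c(j := c j - 1)) (Suc i) \<le> u (Suc i)"
        proof -
          consider "i = j" | "Suc i = j" | "i = Suc j" | "i \<noteq> j" "Suc i \<noteq> j" "i \<noteq> Suc j" by blast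
          then show ?thesis
          proof cases
            case 1 then show ?thesis using dec1[of j "u (Suc j)"] left j0 l by simp
          next
            case 2 then show ?thesis using decr[OF other[of i]] by auto
          next
            case 3 then show ?thesis using l j0 by simp
          next
            case 4 then show ?thesis using other[of i] by simp
          qed
        qed
      qed (use l in auto)
    next
      case r
      show ?thesis
      proof (rule remove[of "Suc (Suc j)"])
        fix i show "w i * (c(Suc (Suc j) := c (Suc (Suc j)) - 1)) i + w (Suc i) * (c(Suc (Suc j) := c (Suc (Suc j)) - 1)) (Suc i) \<le> u (Suc i)"
        proof -
          consider "i = j" | "i = Suc (Suc j)" | "i = Suc j" | "i \<noteq> j" "i \<noteq> Suc (Suc j)" "i \<noteq> Suc j" by blast
          then show ?thesis
          proof cases
            case 1 then show ?thesis using r j0 by simp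
          next
            case 2 then show ?thesis using decl[OF other[of i]] by simp
          next
            case 3 then show ?thesis using dec1[of "Suc (Suc j)" "u (Suc (Suc j))"] right j0 r by simp
          next
            case 4 then show ?thesis using other[of i] by simp
          qed
        qed
      qed (use r in auto)
    next
      case none
      have "\<exists>i. 0 < c i" using c(2) by (metis gr0I sum.neutral nat.distinct(1))
      then obtain k where k: "0 < c k" by blast
      then have kn: "k \<noteq> j" "k \<noteq> Suc j" "k \<noteq> Suc (Suc j)" using j0 none by auto
      show ?thesis
      proof (rule remove[of k])
        fix i show "w i * (c(k := c k - 1)) i + w (Suc i) * (c(k := c k - 1)) (Suc i) \<le> u (Suc i)"
        proof -
          consider "i = j" | "i = k" | "i = Suc j" | "Suc i = k" | "i \<noteq> j" "i \<noteq> k" "Suc i \<noteq> k" "i \<noteq> Suc j"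
            by blast
          then show ?thesis
          proof cases
            case 1 then show ?thesis using none j0 kn by simp
          next
            case 2 then show ?thesis using decl[OF other[of i]] kn by simp
          next
            case 3 then show ?thesis using none j0 kn by simp
          next
            case 4 then show ?thesis using decr[OF other[of i]] kn by auto
          next
            case 5 then show ?thesis using other[of i] by simp
          qed
        qed
      qed (rule k)
    next
      case both
      have "\<not> (j = 0 \<or> n \<le> j)" "\<not> (Suc (Suc j) = 0 \<or> n \<le> Suc (Suc j))"
        using c(1)[of j] c(1)[of "Suc (Suc j)"] both by (metis less_irrefl)+
      then have jn: "j \<noteq> 0" "Suc (Suc j) < n" by auto
      \<comment> \<open>An end edge lacks one neighbour, so both neighbours are heavy. Trading one
        copy of each for one copy of edge \<open>Suc j\<close> lowers the total by one. At each end
        of that edge at least 2 is released: one unit covers the additional variable, the other the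
        new copy.\<close>
      then have w2: "w j \<ge> 2" "w (Suc (Suc j)) \<ge> 2" using ends by auto
      define c1 where "c1 = c(j := c j - 1)"
      define c2 where "c2 = c1(Suc (Suc j) := c (Suc (Suc j)) - 1)"
      define c3 where "c3 = c2(Suc j := 1)"
      have v: "c3 j = c j - 1" "c3 (Suc j) = 1" "c3 (Suc (Suc j)) = c (Suc (Suc j)) - 1"
        "\<And>i. i \<noteq> j \<Longrightarrow> i \<noteq> Suc j \<Longrightarrow> i \<noteq> Suc (Suc j) \<Longrightarrow> c3 i = c i"
        by (auto simp: c3_def c2_def c1_def)
      have sum3: "(\<Sum>i<n. c3 i) = t"
      proof -
        have "(\<Sum>i<n. c1 i) + c j = (\<Sum>i<n. c i) + (c j - 1)"
          unfolding c1_def using jn by (intro sum_upd) auto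
        moreover have "(\<Sum>i<n. c2 i) + c1 (Suc (Suc j)) = (\<Sum>i<n. c1 i) + (c (Suc (Suc j)) - 1)"
          unfolding c2_def using jn by (intro sum_upd) auto
        moreover have "(\<Sum>i<n. c3 i) + c2 (Suc j) = (\<Sum>i<n. c2 i) + 1"
          unfolding c3_def using jn by (intro sum_upd) auto
        moreover have "c1 (Suc (Suc j)) = c (Suc (Suc j))" "c2 (Suc j) = 0"
          by (auto simp: c2_def c1_def j0)
        ultimately show ?thesis using both c(2) by linarith
      qed
      have dec2: "w i * (c i - 1) + 1 \<le> x" if "w i * c i \<le> Suc x" "0 < c i" "w i \<ge> 2" for i x
      proof -
        have "w i * c i = w i * (c i - 1) + w i" using that by (cases "c i") auto
        then show ?thesis using that by linarith
      qed
      show ?thesis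
      proof (rule path_powerI[OF _ sum3])
        fix i show "i = 0 \<or> n \<le> i \<Longrightarrow> c3 i = 0" using c(1)[of i] jn by (auto simp: c3_def c2_def c1_def)
        show "w i * c3 i + w (Suc i) * c3 (Suc i) \<le> u (Suc i)"
        proof -
          consider "i = j" | "i = Suc j" | "i = Suc (Suc j)" | "Suc i = j"
            | "i \<noteq> j" "i \<noteq> Suc j" "i \<noteq> Suc (Suc j)" "Suc i \<noteq> j" by blast
          then show ?thesis
          proof cases
            case 1 then show ?thesis using v w left j0 both w2 dec2[of j "u (Suc j)"] by simp
          next
            case 2 then show ?thesis using v w right j0 both w2 dec2[of "Suc (Suc j)" "u (Suc (Suc j))"] by simp
          next
            case 3 then show ?thesis using v(3) v(4)[of "Suc i"] decl[OF other[of i]] by simp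
          next
            case 4 then show ?thesis using v(1) v(4)[of i] decr[OF other[of i]] by auto
          next
            case 5 then show ?thesis using v(4)[of i] v(4)[of "Suc i"] other[of i] by auto
          qed
        qed
      qed
    qed
  qed
qed

lemma path_power_SucE:
  assumes "path_power w n (Suc t) v"
  obtains k where "1 \<le> k" "k < n" "w k \<le> v k" "w k \<le> v (Suc k)"
    "path_power w n t (\<lambda>i. v i - (if i = k \<or> i = Suc k then w k else 0))"
proof -
  from assms obtain c where c: "\<And>i. i = 0 \<or> n \<le> i \<Longrightarrow> c i = 0" "(\<Sum>i<n. c i) = Suc t"
      "\<And>i. w i * c i + w (Suc i) * c (Suc i) \<le> v (Suc i)" by (rule path_powerE) blast
  have "\<exists>k. 0 < c k" using c(2) by (metis gr0I sum.neutral nat.distinct(1))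
  then obtain k where k: "0 < c k" by blast
  have "\<not> (k = 0 \<or> n \<le> k)" using c(1)[of k] k by (metis less_irrefl)
  then have kn: "1 \<le> k" "k < n" by auto
  have eq: "w k * c k = w k * (c k - 1) + w k" using k by (cases "c k") auto
  have "w k \<le> v k" "w k \<le> v (Suc k)"
    using c(3)[of "k - 1"] c(3)[of k] kn eq by (auto simp: Suc_diff_Suc)
  moreover have "path_power w n t (\<lambda>i. v i - (if i = k \<or> i = Suc k then w k else 0))"
    using c(1,2) k
  proof (rule path_power_remove_edge)
    fix i
    show "w i * (c(k := c k - 1)) i + w (Suc i) * (c(k := c k - 1)) (Suc i)
        \<le> v (Suc i) - (if Suc i = k \<or> Suc i = Suc k then w k else 0)"
      using c(3)[of i] eq by auto
  qed
  ultimately show ?thesis using that kn by blast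
qed

lemma path_power_1: "path_power w (Suc 0) t u \<longleftrightarrow> t = 0"
  by (auto simp: path_power_def intro: exI[of _ "\<lambda>i. 0"])

lemma path_power_2: "path_power w 2 t u \<longleftrightarrow> w 1 * t \<le> u 1 \<and> w 1 * t \<le> u 2"
proof
  assume "path_power w 2 t u"
  then obtain c where c: "\<And>i. i = 0 \<or> 2 \<le> i \<Longrightarrow> c i = 0" "(\<Sum>i<2. c i) = t"
      "\<And>i. w i * c i + w (Suc i) * c (Suc i) \<le> u (Suc i)" by (rule path_powerE) blast
  then show "w 1 * t \<le> u 1 \<and> w 1 * t \<le> u 2"
    using c(3)[of 0] c(3)[of 1] by (auto simp: numeral_eq_Suc)
next
  assume "w 1 * t \<le> u 1 \<and> w 1 * t \<le> u 2"
  then show "path_power w 2 t u"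
    by (intro path_powerI[of _ "\<lambda>i. if i = 1 then t else 0"]) (auto simp: numeral_eq_Suc)
qed

lemma path_power_3:
  "path_power w 3 t u \<longleftrightarrow> (\<exists>a b. a + b = t \<and> w 1 * a \<le> u 1 \<and> w 1 * a + w 2 * b \<le> u 2 \<and> w 2 * b \<le> u 3)"
  (is "_ \<longleftrightarrow> ?rhs")
proof
  assume "path_power w 3 t u"
  then obtain c where c: "\<And>i. i = 0 \<or> 3 \<le> i \<Longrightarrow> c i = 0" "(\<Sum>i<3. c i) = t"
      "\<And>i. w i * c i + w (Suc i) * c (Suc i) \<le> u (Suc i)" by (rule path_powerE) blast
  then show ?rhs
    using c(3)[of 0] c(3)[of 1] c(3)[of 2]
    by (intro exI[of _ "c 1"] exI[of _ "c 2"]) (auto simp: numeral_eq_Suc)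
next
  assume ?rhs
  then obtain a b where "a + b = t" "w 1 * a \<le> u 1" "w 1 * a + w 2 * b \<le> u 2" "w 2 * b \<le> u 3" by blast
  then show "path_power w 3 t u"
    by (intro path_powerI[of _ "\<lambda>i. if i = 1 then a else if i = 2 then b else 0"]) (auto simp: numeral_eq_Suc)
qed

lemma path_power_5:
  "path_power w 5 t u \<longleftrightarrow> (\<exists>a b c d. a + b + c + d = t \<and> w 1 * a \<le> u 1 \<and> w 1 * a + w 2 * b \<le> u 2 \<and>
     w 2 * b + w 3 * c \<le> u 3 \<and> w 3 * c + w 4 * d \<le> u 4 \<and> w 4 * d \<le> u 5)"
  (is "_ \<longleftrightarrow> ?rhs")
proof
  assume "path_power w 5 t u"
  then obtain c where c: "\<And>i. i = 0 \<or> 5 \<le> i \<Longrightarrow> c i = 0" "(\<Sum>i<5. c i) = t"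
      "\<And>i. w i * c i + w (Suc i) * c (Suc i) \<le> u (Suc i)" by (rule path_powerE) blast
  then have "c 1 + c 2 + c 3 + c 4 = t" by (simp add: eval_nat_numeral)
  moreover have "w 1 * c 1 \<le> u 1" "w 1 * c 1 + w 2 * c 2 \<le> u 2" "w 2 * c 2 + w 3 * c 3 \<le> u 3"
    "w 3 * c 3 + w 4 * c 4 \<le> u 4" "w 4 * c 4 \<le> u 5"
    using c(1)[of 0] c(1)[of 5] c(3)[of 0] c(3)[of 1] c(3)[of 2] c(3)[of 3] c(3)[of 4]
    by (simp_all del: One_nat_def add: One_nat_def[symmetric])
  ultimately show ?rhs by blast
next
  assume ?rhs
  then obtain a b c d where "a + b + c + d = t" "w 1 * a \<le> u 1" "w 1 * a + w 2 * b \<le> u 2"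
    "w 2 * b + w 3 * c \<le> u 3" "w 3 * c + w 4 * d \<le> u 4" "w 4 * d \<le> u 5" by blast
  note abcd = this
  define e where "e i = (if i = 1 then a else if i = 2 then b else if i = 3 then c else if i = 4 then d else 0)"
    for i :: nat
  show "path_power w 5 t u"
  proof (rule path_powerI[of _ e])
    show "(\<Sum>i<5. e i) = t" using abcd(1) by (simp add: eval_nat_numeral e_def)
    fix i :: nat
    consider "i = 0" | "i = 1" | "i = 2" | "i = 3" | "i = 4" | "5 \<le> i" by linarith
    then show "w i * e i + w (Suc i) * e (Suc i) \<le> u (Suc i)"
      using abcd by cases (simp_all add: e_def One_nat_def[symmetric] del: One_nat_def)
  qed (auto simp: e_def)
qed

text \<open>The five-vertex formula at exponent zero on vertex 5, where \<open>w 4 > 0\<close> rules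
  out the fourth edge.\<close>

lemma path_power_4:
  assumes "w 4 > 0"
  shows "path_power w 4 t u \<longleftrightarrow> (\<exists>a b c. a + b + c = t \<and> w 1 * a \<le> u 1 \<and> w 1 * a + w 2 * b \<le> u 2 \<and>
     w 2 * b + w 3 * c \<le> u 3 \<and> w 3 * c \<le> u 4)"
proof -
  have "path_power w 4 t u \<longleftrightarrow> path_power w 4 t (u(5 := 0))"
    using path_power_local[of 4 u "u(5 := 0)"] path_power_local[of 4 "u(5 := 0)" u] by auto
  also have "\<dots> \<longleftrightarrow> path_power w 5 t (u(5 := 0))"
    using path_power_restrict[of "u(5 := 0)" 4 w t] assms by simp
  also have "\<dots> \<longleftrightarrow> (\<exists>a b c. a + b + c = t \<and> w 1 * a \<le> u 1 \<and> w 1 * a + w 2 * b \<le> u 2 \<and>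
     w 2 * b + w 3 * c \<le> u 3 \<and> w 3 * c \<le> u 4)"
    using assms by (auto simp: path_power_5)
  finally show ?thesis .
qed

text \<open>Killing x_{m+2} leaves the path on m+1 vertices with x_{m+3} free (\<open>two\<close>).
  After the colon by x_{m+2}, the colon by x_{m+3} cancels the last edge (\<open>same\<close>).
  Killing x_{m+3} makes edge m+1 the last one: the colon by x_{m+1} cancels it (\<open>one\<close>),
  and killing x_{m+1} leaves the path on m vertices with x_{m+2} free
  (\<open>three\<close>).\<close>

lemma filtered_over_path_step:
  assumes n: "m + 3 \<le> N" and A: "A \<inter> {..m + 3} = {}"
    and w: "w (m + 1) = 1" "w (m + 2) = 1" "m > 0 \<Longrightarrow> w m > 0"
    and same: "filtered_over N d A (path_power w (m + 3) t)"
    and two: "filtered_over N d (insert (m + 2) A) (path_power w (m + 1) (Suc t))"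
    and one: "filtered_over N d (insert (m + 3) A) (path_power w (m + 2) t)"
    and three: "filtered_over N d (insert (m + 1) (insert (m + 3) A)) (path_power w m (Suc t))"
  shows "filtered_over N d A (path_power w (m + 3) (Suc t))"
proof (rule filtered_over_split[of "m + 2"])
  note pp = path_power_restrict
  let ?Q = "\<lambda>n t u. path_power w n t (u(m + 2 := Suc (u (m + 2))))"
  have "path_power w (m + 3) (Suc t) u \<longleftrightarrow> path_power w (m + 1) (Suc t) u" if "u (m + 2) = 0" for u
    using that pp[of u "m + 2" w "Suc t"] pp[of u "m + 1" w "Suc t"] w by (simp add: numeral_eq_Suc)
  with two show "filtered_over N d (insert (m + 2) A) (path_power w (m + 3) (Suc t))"
      by (rule filtered_over_insert_cong)
  show "filtered_over N d A (?Q (m + 3) (Suc t))"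
  proof (rule filtered_over_split[of "m + 3"])
    have upd: "(u(m + 3 := Suc (u (m + 3))))(m + 2 := Suc ((u(m + 3 := Suc (u (m + 3)))) (m + 2)))
        = u(Suc (m + 1) := Suc (u (Suc (m + 1))), Suc (Suc (m + 1)) := Suc (u (Suc (Suc (m + 1)))))" for u :: "nat \<Rightarrow> nat"
      by (auto simp: fun_eq_iff numeral_eq_Suc)
    have "?Q (m + 3) (Suc t) (u(m + 3 := Suc (u (m + 3)))) \<longleftrightarrow> path_power w (m + 3) t u" for u
      unfolding upd using w by (intro path_power_colon_edge) (auto simp: numeral_eq_Suc)
    then show "filtered_over N d A (\<lambda>u. ?Q (m + 3) (Suc t) (u(m + 3 := Suc (u (m + 3)))))"
      using same by simp
    have "filtered_over N d (insert (m + 3) A) (?Q (m + 2) (Suc t))"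
    proof (rule filtered_over_split[of "m + 1"])
      have upd: "(u(m + 1 := Suc (u (m + 1))))(m + 2 := Suc ((u(m + 1 := Suc (u (m + 1)))) (m + 2)))
          = u(Suc m := Suc (u (Suc m)), Suc (Suc m) := Suc (u (Suc (Suc m))))" for u :: "nat \<Rightarrow> nat"
        by (auto simp: fun_eq_iff numeral_eq_Suc)
      have "?Q (m + 2) (Suc t) (u(m + 1 := Suc (u (m + 1)))) \<longleftrightarrow> path_power w (m + 2) t u" for u
        unfolding upd using w by (intro path_power_colon_edge) (auto simp: numeral_eq_Suc)
      then show "filtered_over N d (insert (m + 3) A) (\<lambda>u. ?Q (m + 2) (Suc t) (u(m + 1 := Suc (u (m + 1)))))"
        using one by simp
      have "?Q (m + 2) (Suc t) u \<longleftrightarrow> path_power w m (Suc t) u" if "u (m + 1) = 0" for u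
      proof -
        let ?u = "u(m + 2 := Suc (u (m + 2)))"
        have "?Q (m + 2) (Suc t) u \<longleftrightarrow> path_power w m (Suc t) ?u"
          using that pp[of ?u "m + 1" w "Suc t"] pp[of ?u m w "Suc t"] w by simp
        \<comment> \<open>The exponent raised at m+2 lies beyond the remaining path.\<close>
        also have "\<dots> \<longleftrightarrow> path_power w m (Suc t) u"
          using path_power_local[of m u ?u] path_power_local[of m ?u u] by auto
        finally show ?thesis .
      qed
      with three show "filtered_over N d (insert (m + 1) (insert (m + 3) A)) (?Q (m + 2) (Suc t))"
      by (rule filtered_over_insert_cong)
    qed (use n A in auto)
    moreover have "?Q (m + 3) (Suc t) u \<longleftrightarrow> ?Q (m + 2) (Suc t) u" if "u (m + 3) = 0" for u
      using that pp[of "u(m + 2 := Suc (u (m + 2)))" "m + 2" w "Suc t"] w by (simp add: numeral_eq_Suc)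
    ultimately show "filtered_over N d (insert (m + 3) A) (?Q (m + 3) (Suc t))"
      by (rule filtered_over_insert_cong)
  qed (use n A in auto)
qed (use n A in auto)

text \<open>The last premise says d \<le> (N - n - |A|) + max(ceil((n-t+1)/3), 1): the first term
  counts free variables beyond the path, and \<open>(n + 3 - t) div 3\<close> is the ceiling, cut
  off at 0.\<close>

lemma filtered_over_path_light:
  assumes w: "w 1 > 0" "\<And>i. 2 \<le> i \<Longrightarrow> i < N \<Longrightarrow> w i = 1"
  shows "1 \<le> n \<Longrightarrow> n \<le> N \<Longrightarrow> A \<subseteq> {Suc n..N} \<Longrightarrow>
    d + n + card A \<le> N + max ((n + 3 - t) div 3) 1 \<Longrightarrow> filtered_over N d A (path_power w n t)"
proof (induction "n + t" arbitrary: n t A rule: less_induct)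
  case less
  note A = \<open>A \<subseteq> {Suc n..N}\<close>
  have fin: "finite A" using A finite_subset by blast
  show ?case
  proof (cases t)
    case 0
    then show ?thesis by (auto intro: filtered_over_unit path_power_0)
  next
    case (Suc s)
    consider "n = 1" | "n = 2" | "n = 3" | m where "n = m + 3" "1 \<le> m"
      using less.prems(1) le_Suc_ex[of 4 n] by (cases "4 \<le> n") force+
    then show ?thesis
    proof cases
      case 1
      then show ?thesis using less.prems Suc by (intro filtered_over_prime) (auto simp: path_power_1)
    next
      case 2
      then show ?thesis using less.prems Suc
        by (simp only: 2 path_power_2[abs_def]) (intro filtered_over_principal, auto)
    next
      case 3
      then have "filtered_over N d A (\<lambda>u. \<exists>s r. s + r = t \<and> w 1 * s \<le> u 1 \<and> w 1 * s + r \<le> u 2 \<and> r \<le> u 3)"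
        using less.prems Suc w(1) by (intro filtered_over_three_path) auto
      moreover have "w 2 = 1" using w(2)[of 2] less.prems 3 by simp
      ultimately show ?thesis by (simp add: 3 path_power_3[abs_def])
    next
      case (4 m)
      define \<beta> where "\<beta> n t = max ((n + 3 - t) div 3) 1" for n t :: nat
      note hyps = less.hyps[folded \<beta>_def]
      \<comment> \<open>These match the four premises of \<open>filtered_over_path_step\<close>. The
        \<open>+ 1\<close> occurs where a path vertex has become a free variable.\<close>
      have bounds: "\<beta> (m + 3) (Suc s) \<le> \<beta> (m + 1) (Suc s) + 1" "\<beta> (m + 3) (Suc s) \<le> \<beta> (m + 2) s"
        "\<beta> (m + 3) (Suc s) \<le> \<beta> (m + 3) s" "\<beta> (m + 3) (Suc s) \<le> \<beta> m (Suc s) + 1"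
        using 4(2) unfolding \<beta>_def by (auto simp: max_def)
      have subs: "A \<subseteq> {Suc (m + 3)..N}" "insert (m + 2) A \<subseteq> {Suc (m + 1)..N}"
        "insert (m + 3) A \<subseteq> {Suc (m + 2)..N}" "insert (m + 1) (insert (m + 3) A) \<subseteq> {Suc m..N}"
        using A less.prems(2) 4(1) by auto
      have "m + 1 \<notin> insert (m + 3) A" "m + 2 \<notin> A" "m + 3 \<notin> A" using subs(1) by auto
      then have card: "card (insert (m + 2) A) = card A + 1" "card (insert (m + 3) A) = card A + 1"
        "card (insert (m + 1) (insert (m + 3) A)) = card A + 2" using fin by simp_all
      have bound: "d + (m + 3) + card A \<le> N + \<beta> (m + 3) (Suc s)"
        using less.prems(4) unfolding \<beta>_def 4(1) Suc .
      have nN: "m + 3 \<le> N" using less.prems(2) 4(1) by simp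
      show ?thesis unfolding 4(1) Suc
      proof (rule filtered_over_path_step)
        show "m + 3 \<le> N" by (rule nN)
        show "A \<inter> {..m + 3} = {}" using subs(1) by auto
        show "w (m + 1) = 1" "w (m + 2) = 1" using w(2) nN 4(2) by auto
        show "w m > 0" if "m > 0" using w(1) w(2)[of m] nN that 4(2) by (cases "m = 1") auto
        show "filtered_over N d A (path_power w (m + 3) s)"
          by (rule hyps) (rule subs | use 4 Suc bounds bound nN in linarith)+
        show "filtered_over N d (insert (m + 2) A) (path_power w (m + 1) (Suc s))"
          by (rule hyps) (rule subs | use 4 Suc bounds bound nN card in linarith)+
        show "filtered_over N d (insert (m + 3) A) (path_power w (m + 2) s)"
          by (rule hyps) (rule subs | use 4 Suc bounds bound nN card in linarith)+
        show "filtered_over N d (insert (m + 1) (insert (m + 3) A)) (path_power w m (Suc s))"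
          by (rule hyps) (rule subs | use 4 Suc bounds bound nN card in linarith)+
      qed
    qed
  qed
qed

text \<open>Edge 3 is among the last two edges and is heavy, so
  \<open>filtered_over_path_step\<close> does not apply. The light middle edge is cancelled instead,
  by the exchange of its two heavy neighbours. Killing x_2 or x_3 leaves a single heavy edge and one
  more free variable.\<close>

lemma filtered_over_path_4:
  assumes "w 1 \<ge> 2" "w 2 = 1" "w 3 \<ge> 2" "w 4 > 0"
    and "4 \<le> N" "A \<subseteq> {5..N}" "d + card A + 2 \<le> N"
  shows "filtered_over N d A (path_power w 4 t)"
proof (induction t)
  case 0
  show ?case by (auto intro: filtered_over_unit path_power_0)
next
  case (Suc t)
  have fin: "finite A" using assms finite_subset by blast
  have notin: "2 \<notin> A" "3 \<notin> A" using assms by auto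
  note [simp] = path_power_4[of w, OF assms(4)]
  have plus2: "filtered_over N d (insert 2 A) (\<lambda>u. w 3 * Suc t \<le> u 3 \<and> w 3 * Suc t \<le> u 4)"
    using assms fin notin by (intro filtered_over_principal) auto
  have plus3: "filtered_over N d (insert 3 A) (\<lambda>u. w 1 * Suc t \<le> u 1 \<and> w 1 * Suc t - 1 \<le> u 2)"
    using assms fin notin by (intro filtered_over_principal) auto
  show ?case
  proof (rule filtered_over_split[of 2])
    have "path_power w 4 (Suc t) u \<longleftrightarrow> w 3 * Suc t \<le> u 3 \<and> w 3 * Suc t \<le> u 4" if "u 2 = 0" for u
      using that assms by auto
    with plus2 show "filtered_over N d (insert 2 A) (path_power w 4 (Suc t))"
      by (rule filtered_over_insert_cong)
    show "filtered_over N d A (\<lambda>u. path_power w 4 (Suc t) (u(2 := Suc (u 2))))"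
    proof (rule filtered_over_split[of 3])
      have upd: "(u(3 := Suc (u 3)))(2 := Suc ((u(3 := Suc (u 3))) 2))
          = u(Suc 1 := Suc (u (Suc 1)), Suc (Suc 1) := Suc (u (Suc (Suc 1))))" for u :: "nat \<Rightarrow> nat"
        by (auto simp: fun_eq_iff numeral_eq_Suc)
      have "path_power w 4 (Suc t) ((u(3 := Suc (u 3)))(2 := Suc ((u(3 := Suc (u 3))) 2))) \<longleftrightarrow> path_power w 4 t u" for u
        unfolding upd using assms by (intro path_power_colon_edge) (auto simp: numeral_eq_Suc)
      then show "filtered_over N d A (\<lambda>u. path_power w 4 (Suc t) ((u(3 := Suc (u 3)))(2 := Suc ((u(3 := Suc (u 3))) 2))))"
        using Suc by (simp only:)
      have "path_power w 4 (Suc t) (u(2 := Suc (u 2))) \<longleftrightarrow> w 1 * Suc t \<le> u 1 \<and> w 1 * Suc t - 1 \<le> u 2" if "u 3 = 0" for u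
        using that assms by auto
      with plus3 show "filtered_over N d (insert 3 A) (\<lambda>u. path_power w 4 (Suc t) (u(2 := Suc (u 2))))"
      by (rule filtered_over_insert_cong)
    qed (use assms in auto)
  qed (use assms in auto)
qed

text \<open>As for four vertices, by cancelling edge 2. Killing x_2 leaves the path on x_3, x_4,
  x_5; killing x_3 leaves two disjoint edges, a complete intersection.\<close>

lemma filtered_over_path_5:
  assumes "w 1 \<ge> 2" "w 2 = 1" "w 3 \<ge> 2" "w 4 = 1"
    and "5 \<le> N" "A \<subseteq> {6..N}" "d + card A + 3 \<le> N"
  shows "filtered_over N d A (path_power w 5 t)"
proof (induction t)
  case 0
  show ?case by (auto intro: filtered_over_unit path_power_0)
next
  case (Suc t)
  have notin: "2 \<notin> A" "3 \<notin> A" using assms by auto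
  have fin: "finite A" using assms finite_subset by blast
  have plus2: "filtered_over N d (insert 2 A)
      (\<lambda>u. \<exists>s r. s + r = Suc t \<and> w 3 * s \<le> u 3 \<and> w 3 * s + r \<le> u 4 \<and> r \<le> u 5)"
    using assms fin notin by (intro filtered_over_three_path) auto
  have plus3: "filtered_over N d (insert 3 A)
      (\<lambda>u. \<exists>s r. s + r = Suc t \<and> w 1 * s \<le> u 1 \<and> w 1 * s \<le> Suc (u 2) \<and> r \<le> u 4 \<and> r \<le> u 5)"
    using assms fin notin by (intro filtered_over_complete_intersection) auto
  show ?case
  proof (rule filtered_over_split[of 2])
    have "path_power w 5 (Suc t) u \<longleftrightarrow> (\<exists>s r. s + r = Suc t \<and> w 3 * s \<le> u 3 \<and> w 3 * s + r \<le> u 4 \<and> r \<le> u 5)"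
      if "u 2 = 0" for u
      using that assms by (auto simp: path_power_5)
    with plus2 show "filtered_over N d (insert 2 A) (path_power w 5 (Suc t))"
      by (rule filtered_over_insert_cong)
    show "filtered_over N d A (\<lambda>u. path_power w 5 (Suc t) (u(2 := Suc (u 2))))"
    proof (rule filtered_over_split[of 3])
      have upd: "(u(3 := Suc (u 3)))(2 := Suc ((u(3 := Suc (u 3))) 2))
          = u(Suc 1 := Suc (u (Suc 1)), Suc (Suc 1) := Suc (u (Suc (Suc 1))))" for u :: "nat \<Rightarrow> nat"
        by (auto simp: fun_eq_iff numeral_eq_Suc)
      have "path_power w 5 (Suc t) ((u(3 := Suc (u 3)))(2 := Suc ((u(3 := Suc (u 3))) 2))) \<longleftrightarrow> path_power w 5 t u" for u
        unfolding upd using assms by (intro path_power_colon_edge) (auto simp: numeral_eq_Suc)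
      then show "filtered_over N d A (\<lambda>u. path_power w 5 (Suc t) ((u(3 := Suc (u 3)))(2 := Suc ((u(3 := Suc (u 3))) 2))))"
        using Suc by (simp only:)
      have "path_power w 5 (Suc t) (u(2 := Suc (u 2))) \<longleftrightarrow>
          (\<exists>s r. s + r = Suc t \<and> w 1 * s \<le> u 1 \<and> w 1 * s \<le> Suc (u 2) \<and> r \<le> u 4 \<and> r \<le> u 5)" if "u 3 = 0" for u
        using that assms by (auto simp: path_power_5)
      with plus3 show "filtered_over N d (insert 3 A) (\<lambda>u. path_power w 5 (Suc t) (u(2 := Suc (u 2))))"
      by (rule filtered_over_insert_cong)
    qed (use assms in auto)
  qed (use assms in auto)
qed

text \<open>The step lands on 3 or 4 vertices only with a free variable gained, so the separate
  budgets 1 and 2 suffice there; \<open>filtered_over_three_path\<close> supplies just 1. The step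
  starts at six vertices, where the last two edges lie beyond edge 3.\<close>

lemma filtered_over_path_heavy:
  assumes w: "w 1 \<ge> 2" "w 3 \<ge> 2" "\<And>i. 2 \<le> i \<Longrightarrow> i < N \<Longrightarrow> i \<noteq> 3 \<Longrightarrow> w i = 1" and N: "5 \<le> N"
  shows "3 \<le> n \<Longrightarrow> n \<le> N \<Longrightarrow> A \<subseteq> {Suc n..N} \<Longrightarrow>
    d + n + card A \<le> N + (if n = 3 then 1 else if n = 4 then 2 else max ((n + 3 - t) div 3) 2) \<Longrightarrow>
    filtered_over N d A (path_power w n t)"
proof (induction "n + t" arbitrary: n t A rule: less_induct)
  case less
  note A = \<open>A \<subseteq> {Suc n..N}\<close>
  have fin: "finite A" using A finite_subset by blast
  have w24: "w 2 = 1" "w 4 = 1" using w(3)[of 2] w(3)[of 4] N by auto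
  show ?case
  proof (cases t)
    case 0
    then show ?thesis by (auto intro: filtered_over_unit path_power_0)
  next
    case (Suc s)
    consider "n = 3" | "n = 4" | "n = 5" | m where "n = m + 3" "3 \<le> m"
      using less.prems(1) le_Suc_ex[of 6 n] by (cases "6 \<le> n") force+
    then show ?thesis
    proof cases
      case 1
      then have "filtered_over N d A (\<lambda>u. \<exists>s r. s + r = t \<and> w 1 * s \<le> u 1 \<and> w 1 * s + r \<le> u 2 \<and> r \<le> u 3)"
        using less.prems w(1) by (intro filtered_over_three_path) auto
      then show ?thesis by (simp add: 1 path_power_3[abs_def] w24)
    next
      case 2
      then show ?thesis using less.prems w w24 by (simp only: 2) (intro filtered_over_path_4, auto)
    next
      case 3
      then show ?thesis using less.prems Suc w w24 by (simp only: 3) (intro filtered_over_path_5, auto)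
    next
      case (4 m)
      define \<beta> where "\<beta> n t = (if n = 3 then 1 else if n = 4 then 2 else max ((n + 3 - t) div 3) (2::nat))" for n t :: nat
      note hyps = less.hyps[folded \<beta>_def]
      have bounds: "\<beta> (m + 3) (Suc s) \<le> \<beta> (m + 1) (Suc s) + 1" "\<beta> (m + 3) (Suc s) \<le> \<beta> (m + 2) s"
        "\<beta> (m + 3) (Suc s) \<le> \<beta> (m + 3) s" "\<beta> (m + 3) (Suc s) \<le> \<beta> m (Suc s) + 1"
        using 4(2) unfolding \<beta>_def by (auto simp: max_def)
      have subs: "A \<subseteq> {Suc (m + 3)..N}" "insert (m + 2) A \<subseteq> {Suc (m + 1)..N}"
        "insert (m + 3) A \<subseteq> {Suc (m + 2)..N}" "insert (m + 1) (insert (m + 3) A) \<subseteq> {Suc m..N}"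
        using A less.prems(2) 4(1) by auto
      have "m + 1 \<notin> insert (m + 3) A" "m + 2 \<notin> A" "m + 3 \<notin> A" using subs(1) by auto
      then have card: "card (insert (m + 2) A) = card A + 1" "card (insert (m + 3) A) = card A + 1"
        "card (insert (m + 1) (insert (m + 3) A)) = card A + 2" using fin by simp_all
      have bound: "d + (m + 3) + card A \<le> N + \<beta> (m + 3) (Suc s)"
        using less.prems(4) unfolding \<beta>_def 4(1) Suc .
      have nN: "m + 3 \<le> N" using less.prems(2) 4(1) by simp
      show ?thesis unfolding 4(1) Suc
      proof (rule filtered_over_path_step)
        show "m + 3 \<le> N" by (rule nN)
        show "A \<inter> {..m + 3} = {}" using subs(1) by auto
        show "w (m + 1) = 1" "w (m + 2) = 1" using w(3) nN 4(2) by auto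
        show "w m > 0" if "m > 0" using w(2) w(3)[of m] nN that 4(2) by (cases "m = 3") auto
        show "filtered_over N d A (path_power w (m + 3) s)"
          by (rule hyps) (rule subs | use 4 Suc bounds bound nN in linarith)+
        show "filtered_over N d (insert (m + 2) A) (path_power w (m + 1) (Suc s))"
          by (rule hyps) (rule subs | use 4 Suc bounds bound nN card in linarith)+
        show "filtered_over N d (insert (m + 3) A) (path_power w (m + 2) s)"
          by (rule hyps) (rule subs | use 4 Suc bounds bound nN card in linarith)+
        show "filtered_over N d (insert (m + 1) (insert (m + 3) A)) (path_power w m (Suc s))"
          by (rule hyps) (rule subs | use 4 Suc bounds bound nN card in linarith)+
      qed
    qed
  qed
qed

section \<open>The depth bound\<close>

lemma esym_in_max_ideal:
  assumes "0 < d" shows "(esym N d :: 'k::comm_ring_1 mpoly) \<in> max_ideal N"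
proof -
  let ?V = "{Var i | i. 1 \<le> i \<and> i \<le> N} :: 'k mpoly set"
  have V: "?V \<subseteq> polyring N" by (auto intro: Var_closed)
  have M: "poly.is_ideal N (max_ideal N :: 'k mpoly set)"
    unfolding max_ideal_def by (rule poly.is_ideal_ideal_gen[OF V])
  have "(\<Prod>i\<in>S. Var i) \<in> (max_ideal N :: 'k mpoly set)" if S: "S \<subseteq> {1..N}" "card S = d" for S
  proof -
    obtain x where x: "x \<in> S" using S assms by (cases "S = {}") auto
    have fin: "finite S" using S finite_subset by blast
    have "(\<Prod>i\<in>S - {x}. Var i :: 'k mpoly) \<in> polyring N"
      using prod_Var_closed[of "S - {x}" N] S by (auto simp only: monomial_ideal_def)
    moreover have "Var x \<in> (max_ideal N :: 'k mpoly set)"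
    proof -
      have "Var x \<in> ?V" using subsetD[OF S(1) x] by auto
      then show ?thesis unfolding max_ideal_def by (rule subsetD[OF poly.ideal_gen_superset])
    qed
    ultimately have "Var x * (\<Prod>i\<in>S - {x}. Var i) \<in> (max_ideal N :: 'k mpoly set)"
      by (intro poly.ideal_mult_right[OF M])
    then show ?thesis by (simp only: prod.remove[OF fin x])
  qed
  then show ?thesis unfolding esym_def by (intro poly.ideal_sum[OF M]) auto
qed

lemma depth_monomial_ideal_ge:
  assumes "filtered N d Q" "upward Q" "\<not> Q (\<lambda>i. 0)"
  shows "enat d \<le> depth (polyring N) (max_ideal N) (monomial_ideal N Q :: 'k::comm_ring_1 mpoly set)"
proof -
  \<comment> \<open>The ideal of all variables, described by exponents so that 1 is visibly
    missing.\<close>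
  let ?M = "monomial_ideal N (\<lambda>u. \<exists>i. 0 < u i) :: 'k mpoly set"
  have "upward (\<lambda>u. \<exists>i. 0 < u i)" using upward_prime[of UNIV] by simp
  then have M: "poly.is_ideal N ?M" by (rule is_ideal_monomial_ideal)
  have "regular_seq (polyring N) (max_ideal N) (monomial_ideal N Q) (esyms N d :: 'k mpoly list)"
  proof (rule poly.regular_seqI)
    show "poly.is_ideal N (monomial_ideal N Q :: 'k mpoly set)" using assms by (intro is_ideal_monomial_ideal)
    show "poly.weakly_regular N (monomial_ideal N Q) (esyms N d :: 'k mpoly list)"
      using assms by (intro weakly_regular_esyms)
    show "set (esyms N d) \<subseteq> (max_ideal N :: 'k mpoly set)" by (auto simp: esyms_def esym_in_max_ideal)
    show "set (esyms N d) \<subseteq> ?M" by (auto simp: esyms_def intro!: esym_in_monomial_ideal)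
    have "\<exists>i. 0 < u i" if "Q u" for u
    proof (rule ccontr)
      assume "\<not> ?thesis"
      then have "u = (\<lambda>i. 0)" by auto
      then show False using that assms by simp
    qed
    then show "monomial_ideal N Q \<subseteq> ?M" by (auto simp: monomial_ideal_def)
    show "1 \<notin> ?M" by (simp add: monomial_ideal_def)
  qed (auto simp: esyms_closed M)
  then have "enat (length (esyms N d :: 'k mpoly list))
      \<le> depth (polyring N) (max_ideal N) (monomial_ideal N Q :: 'k mpoly set)"
    unfolding depth_def by (intro SUP_upper) simp
  then show ?thesis by (simp add: esyms_def del: upt_Suc)
qed

lemma Var_power: "Var i ^ a = (Poly_Mapping.single (Poly_Mapping.single i a) 1 :: 'k::comm_ring_1 mpoly)"
proof (induction a)
  case (Suc a)
  have "Poly_Mapping.single i 1 + Poly_Mapping.single i a = Poly_Mapping.single i (Suc a)"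
    by (simp add: single_add[symmetric])
  then show ?case by (simp add: Suc) (simp add: Var_def mult_single)
qed simp

definition edge_exponent :: "(nat \<Rightarrow> nat) \<Rightarrow> nat \<Rightarrow> nat \<Rightarrow>\<^sub>0 nat" where
  "edge_exponent w k = Poly_Mapping.single k (w k) + Poly_Mapping.single (Suc k) (w k)"

lemma lookup_edge_exponent:
  "Poly_Mapping.lookup (edge_exponent w k) i = (if i = k \<or> i = Suc k then w k else 0)"
  by (auto simp: edge_exponent_def lookup_add lookup_single when_def)

lemma edge_monomial: "Var k ^ w k * Var (Suc k) ^ w k = Poly_Mapping.single (edge_exponent w k) 1"
  by (simp add: Var_power mult_single edge_exponent_def)

lemma upward_path_power: "upward (path_power w n t)"
  by (auto simp: upward_def intro: path_power_mono)

lemma edge_in_monomial_ideal: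
  assumes "1 \<le> k" "k < n"
  shows "Var k ^ w k * Var (Suc k) ^ w k \<in> monomial_ideal n (path_power w n 1)"
  unfolding edge_monomial One_nat_def
proof (rule single_in_monomial_ideal)
  show "Poly_Mapping.keys (edge_exponent w k) \<subseteq> {1..n}"
    using assms by (auto simp: in_keys_iff lookup_edge_exponent split: if_splits)
  show "path_power w n (Suc 0) (Poly_Mapping.lookup (edge_exponent w k))"
    using assms path_power_0 by (rule_tac path_power_add_edge[of w n 0 "\<lambda>i. 0" k]) (auto simp: lookup_edge_exponent)
qed

text \<open>Translates iterated ideal products into \<open>path_power\<close>. One inclusion adds
  edge counts; the other splits one edge generator off each monomial by
  \<open>path_power_SucE\<close>.\<close>

lemma ideal_pow_weighted_path_ideal:
  "ideal_pow (polyring n) (weighted_path_ideal n w) t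
    = (monomial_ideal n (path_power w n t) :: 'k::comm_ring_1 mpoly set)"
proof (induction t)
  case 0
  show ?case by (simp add: monomial_ideal_def path_power_0)
next
  case (Suc t)
  let ?I = "weighted_path_ideal n w :: 'k mpoly set"
  let ?P = "\<lambda>t. monomial_ideal n (path_power w n t) :: 'k mpoly set"
  let ?G = "{a * b | a b. a \<in> ?I \<and> b \<in> ?P t}"
  have P: "poly.is_ideal n (?P t)" for t by (rule is_ideal_monomial_ideal[OF upward_path_power])
  have I: "?I \<subseteq> ?P 1"
    unfolding weighted_path_ideal_def
    by (rule poly.ideal_gen_least[OF P]) (use edge_in_monomial_ideal in blast)
  have prod: "a * b \<in> ?P (Suc t)" if "a \<in> ?P 1" "b \<in> ?P t" for a b :: "'k mpoly"
  proof -
    have "path_power w n (Suc t) (Poly_Mapping.lookup m)" if m: "m \<in> Poly_Mapping.keys (a * b)" for m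
    proof -
      obtain u v where uv: "u \<in> Poly_Mapping.keys a" "v \<in> Poly_Mapping.keys b" "m = u + v"
        using keys_multE[OF m] .
      then have "path_power w n (1 + t) (\<lambda>i. Poly_Mapping.lookup u i + Poly_Mapping.lookup v i)"
        using \<open>a \<in> ?P 1\<close> \<open>b \<in> ?P t\<close> by (intro path_power_add) (auto simp: monomial_ideal_def)
      moreover have "(\<lambda>i. Poly_Mapping.lookup u i + Poly_Mapping.lookup v i) = Poly_Mapping.lookup m"
        by (auto simp: uv lookup_add)
      ultimately show ?thesis by simp
    qed
    then show ?thesis using that by (auto simp: monomial_ideal_def intro: poly.mult_closed)
  qed
  have G: "?G \<subseteq> ?P (Suc t)" using prod I by blast
  have "?P (Suc t) \<subseteq> ideal_gen (polyring n) ?G"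
  proof (rule monomial_ideal_subsetI)
    show "poly.is_ideal n (ideal_gen (polyring n) ?G)"
      using G by (intro poly.is_ideal_ideal_gen) (auto simp: monomial_ideal_def)
    fix m and c :: 'k assume m: "Poly_Mapping.keys m \<subseteq> {1..n}" "path_power w n (Suc t) (Poly_Mapping.lookup m)"
    from m(2) obtain k where k: "1 \<le> k" "k < n" "w k \<le> Poly_Mapping.lookup m k" "w k \<le> Poly_Mapping.lookup m (Suc k)"
      "path_power w n t (\<lambda>i. Poly_Mapping.lookup m i - (if i = k \<or> i = Suc k then w k else 0))"
      by (rule path_power_SucE)
    let ?e = "edge_exponent w k"
    have "?e + (m - ?e) = m"
      using k by (intro poly_mapping_eqI) (auto simp: lookup_add lookup_minus lookup_edge_exponent)
    then have eq: "Poly_Mapping.single m c = (Var k ^ w k * Var (Suc k) ^ w k) * Poly_Mapping.single (m - ?e) c"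
      by (simp add: edge_monomial mult_single)
    have "Poly_Mapping.keys (m - ?e) \<subseteq> {1..n}" using m(1) by (auto simp: in_keys_iff lookup_minus subset_iff)
    moreover have "Poly_Mapping.lookup (m - ?e)
        = (\<lambda>i. Poly_Mapping.lookup m i - (if i = k \<or> i = Suc k then w k else 0))"
      by (auto simp: lookup_minus lookup_edge_exponent)
    ultimately have "Poly_Mapping.single (m - ?e) c \<in> ?P t"
      using k(5) by (intro single_in_monomial_ideal) simp_all
    moreover have "Var k ^ w k * Var (Suc k) ^ w k \<in> ?I"
      unfolding weighted_path_ideal_def
      using k by (intro subsetD[OF poly.ideal_gen_superset]) blast
    ultimately have "Poly_Mapping.single m c \<in> ?G" unfolding eq by blast
    then show "Poly_Mapping.single m c \<in> ideal_gen (polyring n) ?G"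
      by (rule subsetD[OF poly.ideal_gen_superset])
  qed
  moreover have "ideal_gen (polyring n) ?G \<subseteq> ?P (Suc t)" by (rule poly.ideal_gen_least[OF P G])
  ultimately show ?case by (simp add: Suc ideal_mult_def)
qed

lemma depth_path_power_ge:
  assumes "filtered_over n d {} (path_power w n t)" "t \<ge> 1" "\<forall>i\<in>{1..<n}. w i > 0"
  shows "enat d \<le> depth (polyring n) (max_ideal n)
    (ideal_pow (polyring n) (weighted_path_ideal n w :: 'k::comm_ring_1 mpoly set) t)"
  unfolding ideal_pow_weighted_path_ideal
proof (rule depth_monomial_ideal_ge)
  show "filtered n d (path_power w n t)" using assms(1) by (simp add: filtered_over_def)
  show "\<not> path_power w n t (\<lambda>i. 0)"
  proof
    \<comment> \<open>As t \<ge> 1, some edge would be used, and its positive weight would not fit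
      below exponent zero.\<close>
    assume "path_power w n t (\<lambda>i. 0)"
    then have "path_power w n (Suc (t - 1)) (\<lambda>i. 0)" using assms(2) by simp
    then obtain k where "1 \<le> k" "k < n" "w k \<le> 0" by (rule path_power_SucE) blast
    then show False using bspec[OF assms(3), of k] by simp
  qed
qed (rule upward_path_power)

theorem theorem4p17:
  fixes n t :: nat and w :: "nat \<Rightarrow> nat"
  assumes n5: "n \<ge> 5"
    and wpos: "\<forall>i\<in>{1..<n}. w i > 0"
    and icl: "integrally_closed (polyring n) (weighted_path_ideal n w :: 'k::field mpoly set)"
    and w13: "w 1 > w 3"
    and wone: "\<forall>i\<in>{1..<n}. i \<noteq> 1 \<and> i \<noteq> 3 \<longrightarrow> w i = 1"
    and t1: "t \<ge> 1"
  shows "(w 3 = 1 \<longrightarrow>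
           depth (polyring n) (max_ideal n) (ideal_pow (polyring n) (weighted_path_ideal n w :: 'k mpoly set) t)
             \<ge> enat (max (nat \<lceil>(real n - real t + 1) / 3\<rceil>) 1))
       \<and> (w 3 > 1 \<longrightarrow>
           depth (polyring n) (max_ideal n) (ideal_pow (polyring n) (weighted_path_ideal n w :: 'k mpoly set) t)
             \<ge> enat (max (nat \<lceil>(real n - real t + 1) / 3\<rceil>) 2))"
proof (intro conjI impI)
  let ?b = "nat \<lceil>(real n - real t + 1) / 3\<rceil>"
  have "\<lceil>(real n - real t + 1) / 3\<rceil> \<le> int ((n + 3 - t) div 3)"
  proof -
    \<comment> \<open>The remainder modulo 3 is at most 2, so rounding n + 3 - t down still covers n
      + 1 - t; for large t the truncated difference is 0.\<close>
    have "n + 1 \<le> 3 * ((n + 3 - t) div 3) + t" by linarith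
    then have "real n + 1 \<le> 3 * real ((n + 3 - t) div 3) + real t" by linarith
    then show ?thesis by (simp add: ceiling_le_iff field_simps)
  qed
  then have b: "?b \<le> (n + 3 - t) div 3" by linarith
  show "enat (max ?b 1) \<le> depth (polyring n) (max_ideal n)
      (ideal_pow (polyring n) (weighted_path_ideal n w :: 'k mpoly set) t)" if "w 3 = 1"
  proof (rule depth_path_power_ge[OF _ t1 wpos], rule filtered_over_path_light)
    \<comment> \<open>Here N = n and no variable is killed yet, so the budget is the bound
      itself.\<close>
    show "w i = 1" if "2 \<le> i" "i < n" for i using that wone \<open>w 3 = 1\<close> by (cases "i = 3") auto
  qed (use w13 n5 b in auto)
  show "enat (max ?b 2) \<le> depth (polyring n) (max_ideal n)
      (ideal_pow (polyring n) (weighted_path_ideal n w :: 'k mpoly set) t)" if "w 3 > 1"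
  proof (rule depth_path_power_ge[OF _ t1 wpos], rule filtered_over_path_heavy)
    \<comment> \<open>Both special weights are at least 2, since w_1 > w_3 > 1; n \<ge> 5 selects
      the general branch of the budget.\<close>
    show "w i = 1" if "2 \<le> i" "i < n" "i \<noteq> 3" for i using that wone by auto
  qed (use w13 n5 b that in auto)
qed

end
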